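(* Let $N\ge 2$ be an integer, let $\Omega\subset\mathbb{R}^d$ be a bounded convex domain whose boundary has Lebesgue measure zero, let $\mu$ be Lebesgue measure on $\Omega$ normalized to be a probability, and let $u:\Omega\to\mathbb{R}^d$ be a bounded measurable vector field. The following properties are equivalent: (1) $u$ is $N$-cyclically monotone a.e., that is, there exists a measure zero set $\Omega_0$ such that $u$ is $N$-cyclically monotone on $\Omega\setminus\Omega_0$. (2) The infimum of the Monge-Kantorovich problem $$\inf\Big\{\int_{\Omega^N}\langle u(x_1),x_1-x_2\rangle\,d\pi(x_1,\dots,x_N):\ \pi\in\mathcal{P}^\mu_{\mathrm{sym}}(\Omega^N)\Big\}$$ is equal to zero, and is therefore attained by the push-forward of $\mu$ by the map $x\mapsto(x,x,\dots,x)$. (3) The vector field $u$ is in the polar of $\mathcal{S}_N(\Omega,\mu)$, that is, $$\inf\Big\{\int_\Omega\langle u(x),x-Sx\rangle\,d\mu:\ S\in\mathcal{S}_N(\Omega,\mu)\Big\}=0.$$ (4) The projection of $u$ on $\mathcal{S}_N(\Omega,\mu)$ is the identity map, that is, $$\inf\Big\{\int_\Omega|u(x)-Sx|^2\,d\mu:\ S\in\mathcal{S}_N(\Omega,\mu)\Big\}=\int_\Omega|u(x)-x|^2\,d\mu.$$ (5) There exists an $N$-cyclically sub-antisymmetric function $H:\Omega\times\Omega\to\mathbb{R}$ of two variables, which is concave in the first variable, convex in the second variable, and vanishing on the diagonal, such that $$u(x)=\nabla_2H(x,x)\quad\text{for a.e. }x\in\Omega.$$ (6) The following duality holds: $$\inf\Big\{\int_\Omega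 L_H(x,u(x),0,\dots,0)\,d\mu:\ H\in\mathcal{H}_N(\Omega)\Big\}=\sup\Big\{\int_\Omega\langle u(x),Sx\rangle\,d\mu:\ S\in\mathcal{S}_N(\Omega,\mu)\Big\},$$ and the latter (the supremum) is attained at the identity map.
   Context: A domain is a nonempty open connected subset of $\mathbb{R}^d$. For a set $A\subset\mathbb{R}^d$, a map $u$ from $A$ to $\mathbb{R}^d$ is $N$-cyclically monotone on $A$ if for every cycle $x_1,\dots,x_N,x_{N+1}=x_1$ of points in $A$ one has $\sum_{i=1}^N\langle u(x_i),x_i-x_{i+1}\rangle\ge0$. The map $\sigma$ is the cyclic permutation $\sigma(x_1,x_2,\dots,x_{N-1},x_N)=(x_2,x_3,\dots,x_N,x_1)$, with iterates $\sigma^i$. A probability measure $\pi$ on $\Omega^N$ is $\sigma$-invariant if $\int_{\Omega^N}h(x_1,\dots,x_N)\,d\pi=\int_{\Omega^N}h(\sigma(x_1,\dots,x_N))\,d\pi$ for all $h\in L^1(\Omega^N,d\pi)$. $\mathcal{P}^\mu_{\mathrm{sym}}(\Omega^N)$ is the set of $\sigma$-invariant probability measures $\pi$ on $\Omega^N$ whose first marginal is $\mu$. $\mathcal{S}(\Omega,\mu)$ is the set of $\mu$-measure preserving transformations $S:\Omega\to\Omega$, and $\mathcal{S}_N(\Omega,\mu)=\{S\in\mathcal{S}(\Omega,\mu):\ S^N=I\ \mu\text{-a.e.}\}$, where $S^N$ is the $N$-th iterate and $I$ the identity. A function $F$ of two variables on $\Omega\times\Omega$ is $N$-cyclically sub-antisymmetric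 on $\Omega$ if $F(x,x)=0$ for all $x\in\Omega$ and $\sum_{i=1}^NF(x_i,x_{i+1})\le0$ for all cyclic families $x_1,\dots,x_N,x_{N+1}=x_1$ in $\Omega$. $\nabla_2H(x,x)$ denotes the gradient of $y\mapsto H(x,y)$ at $y=x$. $\mathcal{H}_N(\Omega)=\{H\in C(\Omega^N):\ \sum_{i=0}^{N-1}H(\sigma^i(x_1,\dots,x_N))=0\text{ on }\Omega^N\}$. For a function $H$ on $\Omega^N$, $x\in\Omega$ and $p_1,\dots,p_{N-1}\in\mathbb{R}^d$, $$L_H(x,p_1,\dots,p_{N-1})=\sup\Big\{\sum_{i=1}^{N-1}\langle p_i,y_i\rangle-H(x,y_1,\dots,y_{N-1}):\ y_i\in\Omega\Big\};$$ in (6), $L_H(x,u(x),0,\dots,0)$ means $p_1=u(x)$ and $p_2=\dots=p_{N-1}=0$. *)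

theory Defs
  imports "HOL-Probability.Probability"
begin

text \<open>
  Points \<open>(x\<^sub>1, \<dots>, x\<^sub>N)\<close> of \<open>\<Omega>\<^sup>N\<close> are functions on the index set \<open>{..<N}\<close>, so that
  \<open>x 0, x 1, \<dots>\<close> stand for \<open>x\<^sub>1, x\<^sub>2, \<dots>\<close>; the successor of the index \<open>i\<close> in a cycle is
  \<open>Suc i mod N\<close>.
\<close>

definition cyclically_monotone_on :: "nat \<Rightarrow> 'a::real_inner set \<Rightarrow> ('a \<Rightarrow> 'a) \<Rightarrow> bool" where
  "cyclically_monotone_on N A u \<longleftrightarrow>
     (\<forall>x \<in> {..<N} \<rightarrow>\<^sub>E A. 0 \<le> (\<Sum>i<N. u (x i) \<bullet> (x i - x (Suc i mod N))))"

definition cyclically_sub_antisymmetric_on :: "nat \<Rightarrow> 'a set \<Rightarrow> ('a \<Rightarrow> 'a \<Rightarrow> real) \<Rightarrow> bool" where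
  "cyclically_sub_antisymmetric_on N A F \<longleftrightarrow>
     (\<forall>x\<in>A. F x x = 0) \<and>
     (\<forall>x \<in> {..<N} \<rightarrow>\<^sub>E A. (\<Sum>i<N. F (x i) (x (Suc i mod N))) \<le> 0)"

definition cyclic_shift :: "nat \<Rightarrow> (nat \<Rightarrow> 'a) \<Rightarrow> (nat \<Rightarrow> 'a)" where
  "cyclic_shift N x = (\<lambda>i\<in>{..<N}. x (Suc i mod N))"

text \<open>
  Lebesgue measure on \<open>\<Omega>\<close>, normalized. Its \<open>\<sigma>\<close>-algebra consists of the Lebesgue measurable
  subsets of \<open>\<Omega>\<close>, and \<open>\<Omega>\<^sup>N\<close> carries the corresponding product \<open>\<sigma>\<close>-algebra. A Borel probability
  measure on \<open>\<Omega>\<^sup>N\<close> all of whose marginals are \<open>\<mu>\<close> extends uniquely to that product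
  \<open>\<sigma>\<close>-algebra, so the measures considered below correspond to the Borel ones, while
  \<open>x \<mapsto> u (x 0)\<close> is measurable for every Lebesgue measurable \<open>u\<close>.
\<close>

definition normalized_lebesgue_on :: "'a::euclidean_space set \<Rightarrow> 'a measure" where
  "normalized_lebesgue_on \<Omega> = uniform_measure (lebesgue_on \<Omega>) \<Omega>"

definition sym_measures :: "nat \<Rightarrow> 'a measure \<Rightarrow> (nat \<Rightarrow> 'a) measure set" where
  "sym_measures N \<mu> =
     {\<pi>. prob_space \<pi> \<and> sets \<pi> = sets (Pi\<^sub>M {..<N} (\<lambda>_. \<mu>)) \<and>
         (\<forall>h :: (nat \<Rightarrow> 'a) \<Rightarrow> real. integrable \<pi> h \<longrightarrow>
            (\<integral>x. h x \<partial>\<pi>) = (\<integral>x. h (cyclic_shift N x) \<partial>\<pi>)) \<and>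
         distr \<pi> \<mu> (\<lambda>x. x 0) = \<mu>}"

definition diagonal_measure :: "nat \<Rightarrow> 'a measure \<Rightarrow> (nat \<Rightarrow> 'a) measure" where
  "diagonal_measure N \<mu> = distr \<mu> (Pi\<^sub>M {..<N} (\<lambda>_. \<mu>)) (\<lambda>x. \<lambda>i\<in>{..<N}. x)"

definition measure_preserving_maps :: "'a measure \<Rightarrow> ('a \<Rightarrow> 'a) set" where
  "measure_preserving_maps \<mu> = {S \<in> measurable \<mu> \<mu>. distr \<mu> \<mu> S = \<mu>}"

definition N_involutions :: "nat \<Rightarrow> 'a measure \<Rightarrow> ('a \<Rightarrow> 'a) set" where
  "N_involutions N \<mu> = {S \<in> measure_preserving_maps \<mu>. AE x in \<mu>. (S ^^ N) x = x}"

definition cyclically_antisymmetric_functions ::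
    "nat \<Rightarrow> 'a::topological_space set \<Rightarrow> ((nat \<Rightarrow> 'a) \<Rightarrow> real) set" where
  "cyclically_antisymmetric_functions N \<Omega> =
     {H. continuous_on ({..<N} \<rightarrow>\<^sub>E \<Omega>) H \<and>
         (\<forall>x \<in> {..<N} \<rightarrow>\<^sub>E \<Omega>. (\<Sum>i<N. H ((cyclic_shift N ^^ i) x)) = 0)}"

text \<open>
  Here \<open>y (0 := x)\<close> is the tuple \<open>(x, y\<^sub>1, \<dots>, y\<^sub>N\<^sub>-\<^sub>1)\<close>. The supremum can be \<open>\<infinity>\<close>, because \<open>H\<close>
  need not be bounded near the boundary.
\<close>

definition lagrangian ::
    "nat \<Rightarrow> 'a::real_inner set \<Rightarrow> ((nat \<Rightarrow> 'a) \<Rightarrow> real) \<Rightarrow> 'a \<Rightarrow> (nat \<Rightarrow> 'a) \<Rightarrow> ereal" where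
  "lagrangian N \<Omega> H x p =
     (SUP y \<in> {1..<N} \<rightarrow>\<^sub>E \<Omega>. ereal ((\<Sum>i\<in>{1..<N}. p i \<bullet> y i) - H (y(0 := x))))"

text \<open>
  The integral of an extended real function, positive part minus negative part. In the use
  below \<open>lagrangian N \<Omega> H x p \<ge> p 1 \<bullet> x\<close> (take \<open>y\<^sub>i = x\<close>), so the negative part is bounded.
\<close>

definition ereal_integral :: "'a measure \<Rightarrow> ('a \<Rightarrow> ereal) \<Rightarrow> ereal" where
  "ereal_integral M f =
     enn2ereal (\<integral>\<^sup>+x. e2ennreal (f x) \<partial>M) - enn2ereal (\<integral>\<^sup>+x. e2ennreal (- f x) \<partial>M)"

definition all_equivalent :: "bool list \<Rightarrow> bool" where
  "all_equivalent Ps \<longleftrightarrow> (\<forall>P\<in>set Ps. \<forall>Q\<in>set Ps. P \<longleftrightarrow> Q)"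

end

theory Submission imports Defs
begin

text \<open>
  All six properties say that \<open>u\<close> lies in the polar of \<open>\<S>\<^sub>N(\<Omega>, \<mu>)\<close>, that is,
  \<open>\<integral>\<langle>u(x), x - Sx\<rangle> d\<mu> \<ge> 0\<close> whenever \<open>S\<close> preserves \<open>\<mu>\<close> and \<open>S\<^sup>N = I\<close>; this is the
  predicate \<open>in_polar\<close>, and each property is proved equivalent to it.

  Cyclic monotonicity implies the polar condition through the symmetric transport problem. For a
  \<open>\<sigma>\<close>-invariant \<open>\<pi>\<close> the cost \<open>\<langle>u(x\<^sub>1), x\<^sub>1 - x\<^sub>2\<rangle>\<close> may be replaced by its average over the \<open>N\<close>
  cyclic shifts, which is nonnegative \<open>\<pi>\<close>-almost everywhere because every marginal of \<open>\<pi>\<close> is \<open>\<mu>\<close>.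
  The law of \<open>(x, Sx, \<dots>, S\<^sup>N\<^sup>-\<^sup>1x)\<close> under \<open>\<mu>\<close> is such a \<open>\<pi>\<close>, with cost
  \<open>\<integral>\<langle>u(x), x - Sx\<rangle> d\<mu>\<close>, and \<open>S = I\<close> gives the diagonal measure, with cost 0.

  Conversely, take \<open>N\<close> distinct points such that near each of them \<open>u\<close> is close to its value there on
  a set of positive measure; almost every point has this property. These \<open>N\<close> sets contain translates
  of one common set \<open>F\<close> of positive measure (\<open>common_translates\<close>). The map that permutes the \<open>N\<close>
  translates of \<open>F\<close> cyclically and fixes everything else belongs to \<open>\<S>\<^sub>N(\<Omega>, \<mu>)\<close>, and the
  polar condition for it is, up to a small error, the measure of \<open>F\<close> times the cyclic inequality for
  the chosen points. Cycles with repeated points follow by approximation.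

  The projection property is the polar condition with the square expanded, since \<open>S\<close> preserves
  \<open>\<integral>|x|\<^sup>2 d\<mu>\<close>.

  A function \<open>H\<close> as in the saddle representation satisfies \<open>H(x, y) \<ge> \<langle>u(x), y - x\<rangle>\<close> for almost every
  \<open>x\<close>, by convexity in \<open>y\<close>, so sub-antisymmetry of \<open>H\<close> gives cyclic monotonicity. Conversely, if \<open>u\<close>
  is cyclically monotone on a set \<open>A\<close> of full measure, let \<open>H(x, \<sqdot>)\<close> be the supremum of the affine
  functions \<open>y \<mapsto> \<langle>p, y\<rangle> - c\<close> for which \<open>(x, p, c)\<close> lies in the convex hull of the points
  \<open>(z, u(z), \<langle>u(z), z\<rangle>)\<close>, \<open>z \<in> A\<close>. The cyclic inequality is affine in each triple \<open>(x\<^sub>i, p\<^sub>i, c\<^sub>i)\<close>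
  separately, hence passes from these points to their hull, and \<open>H\<close> is cyclically sub-antisymmetric.
  The subgradients of \<open>H(x, \<sqdot>)\<close> at \<open>x\<close> form a monotone operator, so almost everywhere there is only
  one of them (\<open>monotone_operator_single_valued_ae\<close>); it is \<open>u(x)\<close>, and there \<open>H(x, \<sqdot>)\<close> is
  differentiable.

  For the duality, \<open>L\<^sub>H(x, u(x), 0, \<dots>, 0) \<ge> \<langle>u(x), x\<rangle>\<close> for all admissible \<open>H\<close>, because \<open>H\<close> vanishes
  on the diagonal of \<open>\<Omega>\<^sup>N\<close>. Subtracting from the saddle function \<open>H(x\<^sub>1, x\<^sub>2)\<close> its average along the
  cycle gives an admissible function for which equality holds almost everywhere.
\<close>

section \<open>Monotone operators\<close>

text \<open>
  If \<open>x, y\<close> both carry one value of \<open>T\<close> near \<open>p\<close> and another near \<open>q \<noteq> p\<close>, monotonicity applied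
  crosswise makes \<open>x - y\<close> almost orthogonal to \<open>p - q\<close>. The set of all such points is therefore a
  Lipschitz graph over a subset of a hyperplane, hence the Lipschitz image of a negligible set, and countably many pairs \<open>(p, q)\<close>
  suffice.
\<close>

lemma monotone_operator_single_valued_ae:
  fixes T :: "'a::euclidean_space \<Rightarrow> 'a set"
  assumes mono: "\<And>x y p q. p \<in> T x \<Longrightarrow> q \<in> T y \<Longrightarrow> 0 \<le> (p - q) \<bullet> (x - y)"
  shows "negligible {x. \<exists>p\<in>T x. \<exists>q\<in>T x. p \<noteq> q}"
proof -
  obtain D :: "'a set" where D: "countable D" "\<And>X. open X \<Longrightarrow> X \<noteq> {} \<Longrightarrow> \<exists>d\<in>D. d \<in> X"
    using countable_dense_setE by metis
  define B where "B = (\<lambda>(p, q). {x. \<exists>a\<in>T x. \<exists>b\<in>T x. norm (a - p) < norm (p - q) / 4 \<and>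
    norm (b - q) < norm (p - q) / 4})"
  have negl: "negligible (B (p, q))" if "p \<noteq> q" for p q
  proof -
    define d where "d = (p - q) /\<^sub>R norm (p - q)"
    have nd: "norm d = 1" and pq: "p - q = norm (p - q) *\<^sub>R d"
      using that by (auto simp: d_def)
    define m where "m = norm (p - q)"
    have m: "m > 0" using that by (simp add: m_def)
    \<comment> \<open>The orthogonal projection along \<open>p - q\<close>; on \<open>B (p, q)\<close> its inverse \<open>g\<close> will be Lipschitz.\<close>
    define P where "P = (\<lambda>x. x - (d \<bullet> x) *\<^sub>R d)"
    have one_side: "- (norm (x - y) / 2) \<le> d \<bullet> (x - y)" if xy: "x \<in> B (p, q)" "y \<in> B (p, q)" for x y
    proof -
      obtain a b where ab: "a \<in> T x" "b \<in> T y" "norm (a - p) \<le> norm (p - q) / 4" "norm (b - q) \<le> norm (p - q) / 4"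
        using xy unfolding B_def by force
      have "0 \<le> (a - b) \<bullet> (x - y)" by (rule mono[OF ab(1,2)])
      moreover have "(a - b) \<bullet> (x - y) = (p - q) \<bullet> (x - y) + (a - p) \<bullet> (x - y) - (b - q) \<bullet> (x - y)"
        by (simp add: inner_diff_left)
      moreover have "(p - q) \<bullet> (x - y) = m * (d \<bullet> (x - y))"
        using arg_cong[OF pq, of "\<lambda>v. v \<bullet> (x - y)"] unfolding inner_scaleR_left m_def .
      moreover have "\<bar>(a - p) \<bullet> (x - y)\<bar> \<le> m / 4 * norm (x - y)"
        using Cauchy_Schwarz_ineq2[of "a - p" "x - y"] mult_right_mono[OF ab(3) norm_ge_zero[of "x - y"]]
        unfolding m_def by linarith
      moreover have "\<bar>(b - q) \<bullet> (x - y)\<bar> \<le> m / 4 * norm (x - y)"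
        using Cauchy_Schwarz_ineq2[of "b - q" "x - y"] mult_right_mono[OF ab(4) norm_ge_zero[of "x - y"]]
        unfolding m_def by linarith
      ultimately have "0 \<le> m * (d \<bullet> (x - y)) + m / 4 * norm (x - y) + m / 4 * norm (x - y)"
        by linarith
      then have "0 \<le> m * (d \<bullet> (x - y) + norm (x - y) / 2)" by (simp add: distrib_left)
      then show ?thesis using m by (simp add: zero_le_mult_iff)
    qed
    have lip: "norm (x - y) \<le> 2 * norm (P x - P y)" if xy: "x \<in> B (p, q)" "y \<in> B (p, q)" for x y
    proof -
      have "x - y = (P x - P y) + (d \<bullet> (x - y)) *\<^sub>R d"
        by (simp add: P_def algebra_simps)
      then have "norm (x - y) \<le> norm (P x - P y) + norm ((d \<bullet> (x - y)) *\<^sub>R d)"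
        by (metis norm_triangle_ineq)
      moreover have "\<bar>d \<bullet> (x - y)\<bar> \<le> norm (x - y) / 2"
      proof -
        have "d \<bullet> (y - x) = - (d \<bullet> (x - y))" by (simp add: inner_diff_right)
        then show ?thesis
          using one_side[OF xy] one_side[OF xy(2) xy(1)] norm_minus_commute[of x y] by linarith
      qed
      ultimately show ?thesis using nd by simp
    qed
    have inj: "inj_on P (B (p, q))"
      using lip by (fastforce intro: inj_onI)
    define g where "g = inv_into (B (p, q)) P"
    have g: "g (P x) = x" if "x \<in> B (p, q)" for x
      using inj that by (simp add: g_def)
    have "negligible (P ` B (p, q))"
    proof (rule negligible_subset)
      have "d \<noteq> 0" using nd by auto
      then show "negligible {x. d \<bullet> x = 0}"
        by (intro negligible_hyperplane) auto
      show "P ` B (p, q) \<subseteq> {x. d \<bullet> x = 0}"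
        using nd by (auto simp: P_def inner_diff_right dot_square_norm)
    qed
    then have "negligible (g ` P ` B (p, q))"
    proof (rule negligible_locally_Lipschitz_image[rotated])
      show "\<exists>T Ba. open T \<and> x \<in> T \<and> (\<forall>y\<in>P ` B (p, q) \<inter> T. norm (g y - g x) \<le> Ba * norm (y - x))"
        if "x \<in> P ` B (p, q)" for x
        using that by (intro exI[of _ UNIV] exI[of _ 2]) (auto simp: g intro!: lip)
    qed simp
    moreover have "B (p, q) \<subseteq> g ` P ` B (p, q)" using g by (force simp: image_iff)
    ultimately show ?thesis using negligible_subset by blast
  qed
  have "negligible (\<Union>(B ` {(p, q). p \<in> D \<and> q \<in> D \<and> p \<noteq> q}))"
  proof (rule negligible_countable_Union)
    have "{(p, q). p \<in> D \<and> q \<in> D \<and> p \<noteq> q} \<subseteq> D \<times> D" by auto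
    then show "countable (B ` {(p, q). p \<in> D \<and> q \<in> D \<and> p \<noteq> q})"
      using D(1) by (meson countable_SIGMA countable_image countable_subset)
  qed (use negl in auto)
  moreover have "{x. \<exists>p\<in>T x. \<exists>q\<in>T x. p \<noteq> q} \<subseteq> \<Union>(B ` {(p, q). p \<in> D \<and> q \<in> D \<and> p \<noteq> q})"
  proof safe
    fix x a b assume ab: "a \<in> T x" "b \<in> T x" "a \<noteq> b"
    \<comment> \<open>With \<open>p\<close> and \<open>q\<close> within this distance of \<open>a\<close> and \<open>b\<close>, \<open>|p - q| > 6r\<close>, which exceeds the \<open>4r\<close> needed for \<open>x \<in> B (p, q)\<close>.\<close>
    define r where "r = norm (a - b) / 8"
    have r: "r > 0" using ab by (simp add: r_def)
    obtain p q where pq: "p \<in> D" "p \<in> ball a r" "q \<in> D" "q \<in> ball b r"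
      using D(2)[of "ball a r"] D(2)[of "ball b r"] r by auto
    have n: "norm (a - p) < r" "norm (b - q) < r" using pq by (auto simp: dist_norm)
    have "norm (a - b) \<le> norm (a - p) + norm (p - q) + norm (b - q)"
      using norm_triangle_ineq[of "(a - p) + (p - q)" "q - b"] norm_triangle_ineq[of "a - p" "p - q"]
      by (simp add: norm_minus_commute)
    then have "r < norm (p - q) / 4" using n r r_def by linarith
    moreover from this have "p \<noteq> q" using r by auto
    ultimately have "x \<in> B (p, q)"
      using ab(1,2) n unfolding B_def prod.case mem_Collect_eq by (meson less_trans)
    then show "x \<in> \<Union>(B ` {(p, q). p \<in> D \<and> q \<in> D \<and> p \<noteq> q})" using pq \<open>p \<noteq> q\<close> by blast
  qed
  ultimately show ?thesis using negligible_subset by blast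
qed

section \<open>The saddle function of a cyclically monotone field\<close>

lemma cyclically_monotone_onD:
  assumes "cyclically_monotone_on N A u" and "\<And>i. i < N \<Longrightarrow> x i \<in> A"
  shows "0 \<le> (\<Sum>i<N. u (x i) \<bullet> (x i - x (Suc i mod N)))"
proof -
  have "(\<lambda>i\<in>{..<N}. x i) \<in> {..<N} \<rightarrow>\<^sub>E A" using assms(2) by auto
  then have "0 \<le> (\<Sum>i<N. u ((\<lambda>i\<in>{..<N}. x i) i) \<bullet> ((\<lambda>i\<in>{..<N}. x i) i - (\<lambda>i\<in>{..<N}. x i) (Suc i mod N)))"
    using assms(1) unfolding cyclically_monotone_on_def by blast
  also have "\<dots> = (\<Sum>i<N. u (x i) \<bullet> (x i - x (Suc i mod N)))"
    by (rule sum.cong) auto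
  finally show ?thesis .
qed

lemma Suc_mod_neq: "2 \<le> N \<Longrightarrow> i < N \<Longrightarrow> Suc i mod N \<noteq> i"
  by (metis One_nat_def Suc_1 Suc_le_eq lessI less_irrefl_nat mod_less mod_Suc n_not_Suc_n nat_less_le zero_less_Suc)

text \<open>
  In the application \<open>A\<close> is \<open>\<Omega>\<close> without a null set; density is what remains of this for the
  convex-analytic part.
\<close>

locale cyclically_monotone_field =
  fixes N :: nat and \<Omega> A :: "'a::euclidean_space set" and u :: "'a \<Rightarrow> 'a" and M :: real
  assumes N: "2 \<le> N"
    and open_domain: "open \<Omega>" and convex_domain: "convex \<Omega>" and bounded_domain: "bounded \<Omega>"
    and A_subset: "A \<subseteq> \<Omega>" and A_dense: "\<Omega> \<subseteq> closure A"
    and u_bound: "\<And>x. x \<in> A \<Longrightarrow> norm (u x) \<le> M"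
    and monotone: "cyclically_monotone_on N A u"
begin

text \<open>
  A triple \<open>(x, p, c)\<close> stands for the affine function \<open>y \<mapsto> \<langle>p, y\<rangle> - c\<close> attached to the point \<open>x\<close>. The
  generators are \<open>y \<mapsto> \<langle>u(z), y - z\<rangle>\<close> attached to \<open>z\<close>. Taking the hull in the product space makes the
  supremum below the concave envelope in \<open>x\<close> of these functions.
\<close>

definition affine_data :: "('a \<times> 'a \<times> real) set" where
  "affine_data = convex hull ((\<lambda>z. (z, u z, u z \<bullet> z)) ` A)"

definition saddle :: "'a \<Rightarrow> 'a \<Rightarrow> real" where
  "saddle x y = (SUP pc \<in> {pc. (x, pc) \<in> affine_data}. fst pc \<bullet> y - snd pc)"

lemma affine_data_induct [consumes 1]:
  assumes "w \<in> affine_data" and "\<And>z. z \<in> A \<Longrightarrow> P (z, u z, u z \<bullet> z)" and "convex {w. P w}"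
  shows "P w"
  using assms unfolding affine_data_def by (auto intro: hull_induct)

lemma affine_data_combination:
  assumes "(x, p, c) \<in> affine_data" "(y, q, d) \<in> affine_data" "0 \<le> s" "0 \<le> t" "s + t = 1"
  shows "(s *\<^sub>R x + t *\<^sub>R y, s *\<^sub>R p + t *\<^sub>R q, s * c + t * d) \<in> affine_data"
proof -
  have "convex affine_data" by (simp add: affine_data_def)
  then have "s *\<^sub>R (x, p, c) + t *\<^sub>R (y, q, d) \<in> affine_data" using assms convexD by blast
  then show ?thesis by simp
qed

lemma graph_in_affine_data: "z \<in> A \<Longrightarrow> (z, u z, u z \<bullet> z) \<in> affine_data"
  unfolding affine_data_def by (intro hull_inc) auto

text \<open>
  The sum is affine in each triple when the others are held fixed, because no triple is its own
  successor for \<open>N \<ge> 2\<close>. On the generating points it is nonpositive by cyclic monotonicity, so the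
  generating points can be replaced by points of the hull one index at a time.
\<close>

lemma affine_data_cyclic:
  assumes "\<And>i. i < N \<Longrightarrow> w i \<in> affine_data"
  shows "(\<Sum>i<N. fst (snd (w i)) \<bullet> fst (w (Suc i mod N)) - snd (snd (w i))) \<le> 0"
proof -
  define f where "f = (\<lambda>w i. fst (snd (w i :: 'a \<times> 'a \<times> real)) \<bullet> fst (w (Suc i mod N)) - snd (snd (w i)))"
  define \<Phi> where "\<Phi> = (\<lambda>w. \<Sum>i<N. f w i)"
  have affine: "\<Phi> (w(k := s *\<^sub>R a + t *\<^sub>R b)) = s * \<Phi> (w(k := a)) + t * \<Phi> (w(k := b))"
    if "s + t = 1" for w :: "nat \<Rightarrow> 'a \<times> 'a \<times> real" and k s t a b
  proof -
    have t: "t = 1 - s" using that by simp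
    have "f (w(k := s *\<^sub>R a + t *\<^sub>R b)) i = s * f (w(k := a)) i + t * f (w(k := b)) i" if "i < N" for i
      using Suc_mod_neq[OF N that] by (auto simp: f_def t inner_add_left inner_add_right algebra_simps)
    then show ?thesis by (simp add: \<Phi>_def sum_distrib_left sum.distrib)
  qed
  have "\<Phi> w \<le> 0" if "k \<le> N" "\<And>i. i < k \<Longrightarrow> w i \<in> affine_data"
    "\<And>i. k \<le> i \<Longrightarrow> i < N \<Longrightarrow> w i \<in> (\<lambda>z. (z, u z, u z \<bullet> z)) ` A" for k w
    using that
  proof (induction k arbitrary: w)
    case 0
    then have "\<forall>i<N. \<exists>z\<in>A. w i = (z, u z, u z \<bullet> z)" by auto
    then obtain z where z: "\<And>i. i < N \<Longrightarrow> z i \<in> A" "\<And>i. i < N \<Longrightarrow> w i = (z i, u (z i), u (z i) \<bullet> z i)" by metis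
    have "\<Phi> w = - (\<Sum>i<N. u (z i) \<bullet> (z i - z (Suc i mod N)))"
      unfolding \<Phi>_def sum_negf[symmetric] by (rule sum.cong) (auto simp: f_def z inner_diff_right)
    then show ?case using cyclically_monotone_onD[OF monotone z(1)] by auto
  next
    case (Suc k)
    have "\<Phi> (w(k := v)) \<le> 0" if "v \<in> affine_data" for v
      using that
    proof (induction rule: affine_data_induct)
      case (1 z)
      show ?case using Suc.prems 1 by (intro Suc.IH) auto
    next
      show "convex {v. \<Phi> (w(k := v)) \<le> 0}"
      proof (rule convexI)
        fix a b s t assume "a \<in> {v. \<Phi> (w(k := v)) \<le> 0}" "b \<in> {v. \<Phi> (w(k := v)) \<le> 0}"
          and st: "(0::real) \<le> s" "0 \<le> t" "s + t = 1"
        then have "s * \<Phi> (w(k := a)) \<le> 0" "t * \<Phi> (w(k := b)) \<le> 0" by (auto simp: mult_le_0_iff)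
        then show "s *\<^sub>R a + t *\<^sub>R b \<in> {v. \<Phi> (w(k := v)) \<le> 0}" using affine[OF st(3)] by simp
      qed
    qed
    from this[of "w k"] show ?case using Suc.prems(2)[of k] by simp
  qed
  from this[of N w] show ?thesis using assms by (simp add: \<Phi>_def f_def)
qed

lemma affine_data_norm:
  assumes "(x, p, c) \<in> affine_data"
  shows "norm p \<le> M"
proof -
  have "norm (fst (snd (x, p, c))) \<le> M"
    using assms
  proof (induction rule: affine_data_induct)
    have "{w :: 'a \<times> 'a \<times> real. norm (fst (snd w)) \<le> M} = UNIV \<times> cball 0 M \<times> UNIV" by auto
    then show "convex {w :: 'a \<times> 'a \<times> real. norm (fst (snd w)) \<le> M}"
      by (auto intro!: convex_Times)
  qed (simp add: u_bound)
  then show ?thesis by simp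
qed

lemma convex_affine_le: "convex {w :: 'a \<times> 'a \<times> real. fst (snd w) \<bullet> y - snd (snd w) \<le> b}"
proof -
  have "{w :: 'a \<times> 'a \<times> real. fst (snd w) \<bullet> y - snd (snd w) \<le> b} = {w. (0, y, -1) \<bullet> w \<le> b}"
    by (auto simp: inner_prod_def inner_commute)
  then show ?thesis by (simp add: convex_halfspace_le)
qed

lemma affine_data_bdd_above: "bdd_above ((\<lambda>pc. fst pc \<bullet> y - snd pc) ` {pc. (x, pc) \<in> affine_data})"
proof -
  obtain R where R: "\<And>x. x \<in> \<Omega> \<Longrightarrow> norm x \<le> R" using bounded_domain by (auto simp: bounded_iff)
  have "fst (snd (x, p, c)) \<bullet> y - snd (snd (x, p, c)) \<le> M * (norm y + R)" if "(x, p, c) \<in> affine_data" for p c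
    using that
  proof (induction rule: affine_data_induct)
    case (1 z)
    have "u z \<bullet> (y - z) \<le> norm (u z) * norm (y - z)" by (rule norm_cauchy_schwarz)
    also have "\<dots> \<le> M * (norm y + R)"
      using u_bound[OF 1] R[of z] A_subset 1 norm_triangle_ineq4[of y z]
      by (intro mult_mono) (auto intro: order_trans[OF norm_ge_zero])
    finally show ?case by (simp add: inner_diff_right)
  qed (rule convex_affine_le)
  then show ?thesis by (auto simp: bdd_above_def)
qed

lemma affine_data_le_saddle: "(x, p, c) \<in> affine_data \<Longrightarrow> p \<bullet> y - c \<le> saddle x y"
  unfolding saddle_def
  by (rule cSUP_upper2[OF affine_data_bdd_above, of "(p, c)"]) auto

lemma saddle_approx:
  assumes "(x, p0, c0) \<in> affine_data" "e > 0"
  obtains p c where "(x, p, c) \<in> affine_data" "saddle x y < p \<bullet> y - c + e"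
proof -
  have "saddle x y - e < saddle x y" using assms by simp
  then have "\<exists>pc\<in>{pc. (x, pc) \<in> affine_data}. saddle x y - e < fst pc \<bullet> y - snd pc"
    unfolding saddle_def using assms affine_data_bdd_above by (subst (asm) less_cSUP_iff) (auto simp: saddle_def)
  then show ?thesis using that by (force simp: algebra_simps)
qed

text \<open>
  The convex hull of a dense subset of a small ball around \<open>x\<close> contains \<open>x\<close>. Combining only data of
  points near \<open>x\<close> makes the resulting affine function almost nonnegative at \<open>x\<close>. This supplies finiteness of
  \<open>saddle\<close> on all of \<open>\<Omega>\<close>, and its vanishing at the points of the diagonal outside \<open>A\<close>.
\<close>

lemma affine_data_over:
  assumes "x \<in> \<Omega>" "e > 0"
  obtains p c where "(x, p, c) \<in> affine_data" "- e \<le> p \<bullet> x - c"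
proof -
  have M: "M \<ge> 0" 
  proof -
    have "A \<noteq> {}" using A_dense assms by auto
    then show ?thesis using u_bound by (auto intro: order_trans[OF norm_ge_zero])
  qed
  obtain r where r: "r > 0" "ball x r \<subseteq> \<Omega>" using assms open_domain openE by metis
  \<comment> \<open>The denominator \<open>M + 1\<close> covers the case \<open>M = 0\<close>.\<close>
  define r' where "r' = min r (e / (M + 1))"
  have r': "r' > 0" "r' \<le> r" "M * r' \<le> e"
  proof -
    show "r' > 0" "r' \<le> r" using r assms M by (auto simp: r'_def)
    have "M * r' \<le> M * (e / (M + 1))" using M by (intro mult_left_mono) (auto simp: r'_def)
    also have "\<dots> \<le> e" using M assms by (simp add: field_simps)
    finally show "M * r' \<le> e" .
  qed
  define A' where "A' = A \<inter> ball x r'"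
  have "ball x r' \<subseteq> closure A'"
    using open_Int_closure_subset[of "ball x r'" A] r r' A_dense unfolding A'_def
    by (smt (verit) Int_commute inf.absorb_iff1 open_ball subset_ball subset_trans)
  also have "\<dots> \<subseteq> closure (convex hull A')" by (intro closure_mono hull_subset)
  finally have "ball x r' \<subseteq> interior (closure (convex hull A'))" by (simp add: interior_maximal)
  also have "\<dots> = interior (convex hull A')" by (simp add: convex_interior_closure)
  finally have "x \<in> convex hull A'" using r' interior_subset by force
  also have "A' = fst ` (\<lambda>z. (z, u z, u z \<bullet> z)) ` A'" by (force simp: image_image)
  also have "convex hull \<dots> = fst ` (convex hull ((\<lambda>z. (z, u z, u z \<bullet> z)) ` A'))"
    by (simp add: convex_hull_linear_image linear_fst)
  finally obtain p c where pc: "(x, p, c) \<in> convex hull ((\<lambda>z. (z, u z, u z \<bullet> z)) ` A')" by auto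
  have "(x, p, c) \<in> affine_data"
    unfolding affine_data_def by (rule subsetD[OF hull_mono pc]) (auto simp: A'_def)
  moreover have "- e \<le> fst (snd (x, p, c)) \<bullet> x - snd (snd (x, p, c))"
    using pc
  proof (rule hull_induct)
    show "convex {w :: 'a \<times> 'a \<times> real. - e \<le> fst (snd w) \<bullet> x - snd (snd w)}"
    proof -
      have "{w :: 'a \<times> 'a \<times> real. - e \<le> fst (snd w) \<bullet> x - snd (snd w)} = {w. (0, x, -1) \<bullet> w \<ge> - e}"
        by (auto simp: inner_prod_def inner_commute)
      then show ?thesis by (simp add: convex_halfspace_ge)
    qed
  next
    fix w assume "w \<in> (\<lambda>z. (z, u z, u z \<bullet> z)) ` A'"
    then obtain z where z: "w = (z, u z, u z \<bullet> z)" "z \<in> A" "norm (z - x) \<le> r'"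
      by (auto simp: A'_def dist_norm norm_minus_commute)
    have "u z \<bullet> (z - x) \<le> norm (u z) * norm (z - x)" by (rule norm_cauchy_schwarz)
    also have "\<dots> \<le> M * r'" using u_bound z M by (intro mult_mono) auto
    also have "\<dots> \<le> e" by fact
    finally show "- e \<le> fst (snd w) \<bullet> x - snd (snd w)" by (simp add: z inner_diff_right)
  qed
  ultimately show ?thesis using that by simp
qed

lemma saddle_cyclic:
  assumes "\<And>i. i < N \<Longrightarrow> x i \<in> \<Omega>"
  shows "(\<Sum>i<N. saddle (x i) (x (Suc i mod N))) \<le> 0"
proof (rule field_le_epsilon)
  fix e :: real assume e: "e > 0"
  have "\<exists>p c. (x i, p, c) \<in> affine_data \<and> saddle (x i) (x (Suc i mod N)) < p \<bullet> x (Suc i mod N) - c + e / N" if "i < N" for i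
  proof -
    have "0 < e / N" using e N by simp
    then show ?thesis using affine_data_over[OF assms[OF that] e] saddle_approx by metis
  qed
  then obtain p c where pc: "\<And>i. i < N \<Longrightarrow> (x i, p i, c i) \<in> affine_data"
    "\<And>i. i < N \<Longrightarrow> saddle (x i) (x (Suc i mod N)) < p i \<bullet> x (Suc i mod N) - c i + e / N" by metis
  have "(\<Sum>i<N. saddle (x i) (x (Suc i mod N))) \<le> (\<Sum>i<N. (p i \<bullet> x (Suc i mod N) - c i) + e / N)"
    using pc(2) by (intro sum_mono) (auto intro: less_imp_le)
  also have "\<dots> = (\<Sum>i<N. p i \<bullet> x (Suc i mod N) - c i) + e"
    using N by (simp only: sum.distrib) simp
  also have "\<dots> \<le> 0 + e"
    using affine_data_cyclic[of "\<lambda>i. (x i, p i, c i)"] pc(1) by simp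
  finally show "(\<Sum>i<N. saddle (x i) (x (Suc i mod N))) \<le> 0 + e" .
qed

lemma saddle_diagonal: "x \<in> \<Omega> \<Longrightarrow> saddle x x = 0"
proof (rule antisym)
  assume x: "x \<in> \<Omega>"
  have "real N * saddle x x \<le> 0" using saddle_cyclic[of "\<lambda>_. x"] x by simp
  then show "saddle x x \<le> 0" using N by (simp add: mult_le_0_iff)
  show "0 \<le> saddle x x"
  proof (rule field_le_epsilon)
    fix e :: real assume "e > 0"
    from affine_data_over[OF x this] obtain p c where "(x, p, c) \<in> affine_data" "- e \<le> p \<bullet> x - c" .
    then show "0 \<le> saddle x x + e" using affine_data_le_saddle[of x p c x] by simp
  qed
qed

lemma saddle_sub_antisymmetric: "cyclically_sub_antisymmetric_on N \<Omega> saddle"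
  using saddle_diagonal saddle_cyclic by (simp add: cyclically_sub_antisymmetric_on_def PiE_iff)

lemma saddle_tangent: "x \<in> A \<Longrightarrow> u x \<bullet> (y - x) \<le> saddle x y"
  using affine_data_le_saddle[OF graph_in_affine_data] by (simp add: inner_diff_right)

lemma affine_data_exists: "x \<in> \<Omega> \<Longrightarrow> \<exists>p c. (x, p, c) \<in> affine_data"
  by (rule affine_data_over[of x 1]) auto

lemma saddle_le:
  assumes "x \<in> \<Omega>" "\<And>p c. (x, p, c) \<in> affine_data \<Longrightarrow> p \<bullet> y - c \<le> b"
  shows "saddle x y \<le> b"
  unfolding saddle_def using affine_data_exists[OF assms(1)] assms(2) by (intro cSUP_least) auto

lemma saddle_convex: "x \<in> \<Omega> \<Longrightarrow> convex_on \<Omega> (saddle x)"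
proof (rule convex_onI)
  fix t :: real and y z assume x: "x \<in> \<Omega>" and t: "0 < t" "t < 1"
  show "saddle x ((1 - t) *\<^sub>R y + t *\<^sub>R z) \<le> (1 - t) * saddle x y + t * saddle x z"
  proof (rule saddle_le[OF x])
    fix p c assume pc: "(x, p, c) \<in> affine_data"
    have "p \<bullet> ((1 - t) *\<^sub>R y + t *\<^sub>R z) - c = (1 - t) * (p \<bullet> y - c) + t * (p \<bullet> z - c)"
      by (simp add: inner_add_right left_diff_distrib right_diff_distrib)
    also have "\<dots> \<le> (1 - t) * saddle x y + t * saddle x z"
      using t affine_data_le_saddle[OF pc] by (intro add_mono mult_left_mono) auto
    finally show "p \<bullet> ((1 - t) *\<^sub>R y + t *\<^sub>R z) - c \<le> (1 - t) * saddle x y + t * saddle x z" .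
  qed
qed (rule convex_domain)

lemma saddle_concave: "concave_on \<Omega> (\<lambda>x. saddle x y)"
  unfolding concave_on_iff
proof (intro conjI ballI allI impI convex_domain)
  fix x x' s t assume x: "x \<in> \<Omega>" "x' \<in> \<Omega>" and st: "0 \<le> s" "0 \<le> t" "s + t = (1::real)"
  show "s * saddle x y + t * saddle x' y \<le> saddle (s *\<^sub>R x + t *\<^sub>R x') y"
  proof (rule field_le_epsilon)
    fix e :: real assume e: "e > 0"
    obtain p c where p: "(x, p, c) \<in> affine_data" "saddle x y < p \<bullet> y - c + e"
      using affine_data_exists[OF x(1)] saddle_approx e by metis
    obtain q d where q: "(x', q, d) \<in> affine_data" "saddle x' y < q \<bullet> y - d + e"
      using affine_data_exists[OF x(2)] saddle_approx e by metis
    have "s * saddle x y + t * saddle x' y \<le> s * (p \<bullet> y - c + e) + t * (q \<bullet> y - d + e)"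
      using st p q by (intro add_mono mult_left_mono) auto
    also have "\<dots> = (s *\<^sub>R p + t *\<^sub>R q) \<bullet> y - (s * c + t * d) + (s + t) * e"
      by (simp add: inner_add_left algebra_simps)
    also have "\<dots> \<le> saddle (s *\<^sub>R x + t *\<^sub>R x') y + e"
      using affine_data_le_saddle[OF affine_data_combination[OF p(1) q(1) st]] st by simp
    finally show "s * saddle x y + t * saddle x' y \<le> saddle (s *\<^sub>R x + t *\<^sub>R x') y + e" .
  qed
qed

lemma saddle_Lipschitz: 
  assumes "x \<in> \<Omega>"
  shows "\<bar>saddle x y - saddle x z\<bar> \<le> M * norm (y - z)"
proof -
  have "saddle x y \<le> saddle x z + M * norm (y - z)" for y z
  proof (rule saddle_le[OF assms])
    fix p c assume pc: "(x, p, c) \<in> affine_data"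
    have "p \<bullet> (y - z) \<le> norm p * norm (y - z)" by (rule norm_cauchy_schwarz)
    also have "\<dots> \<le> M * norm (y - z)" using affine_data_norm[OF pc] by (intro mult_right_mono) auto
    finally show "p \<bullet> y - c \<le> saddle x z + M * norm (y - z)"
      using affine_data_le_saddle[OF pc, of z] by (simp add: inner_diff_right)
  qed
  from this[of y z] this[of z y] show ?thesis by (simp add: norm_minus_commute)
qed

text \<open>
  Continuity in \<open>x\<close> is that of a concave function on an open set; the Lipschitz bound in \<open>y\<close> is
  uniform in \<open>x\<close>, which makes the continuity joint.
\<close>

lemma saddle_continuous: "continuous_on (\<Omega> \<times> \<Omega>) (\<lambda>z. saddle (fst z) (snd z))"
  unfolding continuous_on_def
proof
  fix z assume "z \<in> \<Omega> \<times> \<Omega>"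
  then obtain x y where z: "z = (x, y)" "x \<in> \<Omega>" "y \<in> \<Omega>" by auto
  let ?F = "at z within \<Omega> \<times> \<Omega>"
  have fst: "(fst \<longlongrightarrow> x) ?F" and snd: "(snd \<longlongrightarrow> y) ?F"
    by (auto simp: z intro!: tendsto_eq_intros)
  have "continuous_on \<Omega> (\<lambda>x. - saddle x y)"
    using saddle_concave open_domain by (intro convex_on_continuous) (auto simp: concave_on_def)
  then have "continuous_on \<Omega> (\<lambda>x. saddle x y)"
    using continuous_on_minus by fastforce
  then have "isCont (\<lambda>x. saddle x y) x"
    using open_domain z by (simp add: continuous_on_eq_continuous_at)
  then have lim: "((\<lambda>v. saddle (fst v) y) \<longlongrightarrow> saddle x y) ?F"
    by (rule isCont_tendsto_compose) (rule fst)
  have "((\<lambda>v. saddle (fst v) (snd v) - saddle (fst v) y) \<longlongrightarrow> 0) ?F"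
  proof (rule Lim_null_comparison)
    show "\<forall>\<^sub>F v in ?F. norm (saddle (fst v) (snd v) - saddle (fst v) y) \<le> M * norm (snd v - y)"
      using saddle_Lipschitz unfolding eventually_at_filter by (intro always_eventually) auto
    show "((\<lambda>v. M * norm (snd v - y)) \<longlongrightarrow> 0) ?F"
      by (rule tendsto_eq_intros snd | simp)+
  qed
  from tendsto_add[OF this lim]
  show "((\<lambda>z. saddle (fst z) (snd z)) \<longlongrightarrow> saddle (fst z) (snd z)) ?F" by (simp add: z)
qed

definition subgradients :: "'a \<Rightarrow> 'a set" where
  "subgradients x = {p. x \<in> \<Omega> \<and> (\<forall>y\<in>\<Omega>. p \<bullet> (y - x) \<le> saddle x y)}"

text \<open>
  Apply sub-antisymmetry to the cycle \<open>x, y, \<dots>, y\<close>: only the two steps between \<open>x\<close> and \<open>y\<close>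
  contribute.
\<close>

lemma subgradients_monotone:
  assumes "p \<in> subgradients x" "q \<in> subgradients y"
  shows "0 \<le> (p - q) \<bullet> (x - y)"
proof -
  have xy: "x \<in> \<Omega>" "y \<in> \<Omega>" using assms by (auto simp: subgradients_def)
  \<comment> \<open>For \<open>N = 2\<close> there are no intermediate steps at \<open>y\<close>.\<close>
  define z where "z = (\<lambda>i::nat. if i = 0 then x else y)"
  define f where "f = (\<lambda>i. saddle (z i) (z (Suc i mod N)))"
  have "(\<Sum>i<N. f i) = (\<Sum>i\<in>{0, N - 1}. f i)"
  proof (rule sum.mono_neutral_right)
    show "\<forall>i\<in>{..<N} - {0, N - 1}. f i = 0"
    proof
      fix i assume "i \<in> {..<N} - {0, N - 1}"
      then have "i \<noteq> 0" "Suc i < N" by auto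
      then show "f i = 0" using saddle_diagonal xy by (simp add: f_def z_def)
    qed
  qed (use N in auto)
  also have "\<dots> = saddle x y + saddle y x" using N by (simp add: f_def z_def)
  finally have "saddle x y + saddle y x \<le> 0"
    using saddle_cyclic[of z] xy by (simp add: f_def z_def)
  moreover have "p \<bullet> (y - x) \<le> saddle x y" "q \<bullet> (x - y) \<le> saddle y x"
    using assms xy by (auto simp: subgradients_def)
  ultimately show ?thesis by (simp add: inner_diff_left inner_diff_right)
qed

text \<open>
  Otherwise choose \<open>y\<^sub>n \<longrightarrow> x\<close> at which the difference quotient stays away from 0, and affine functions
  with slopes \<open>p\<^sub>n\<close> that nearly attain the supremum at \<open>y\<^sub>n\<close>. The slopes are bounded; a limit of them
  is a subgradient at \<open>x\<close>, hence equals \<open>u x\<close>, and the difference quotient at \<open>y\<^sub>n\<close> is at most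
  \<open>|p\<^sub>n - u x|\<close> up to a vanishing error.
\<close>

lemma saddle_gderiv:
  assumes x: "x \<in> A" and unique: "\<And>p. p \<in> subgradients x \<Longrightarrow> p = u x"
  shows "GDERIV (saddle x) x :> u x"
proof -
  have x\<Omega>: "x \<in> \<Omega>" using x A_subset by auto
  have "((\<lambda>y. norm (saddle x y - saddle x x - (y - x) \<bullet> u x) / norm (y - x)) \<longlongrightarrow> 0) (at x)"
    unfolding tendsto_iff
  proof (rule allI, rule impI, rule ccontr)
    fix e :: real assume e: "e > 0"
    assume "\<not> (\<forall>\<^sub>F y in at x. dist (norm (saddle x y - saddle x x - (y - x) \<bullet> u x) / norm (y - x)) 0 < e)"
    then have "\<exists>y. y \<noteq> x \<and> dist y x < d \<and> e \<le> norm (saddle x y - saddle x x - (y - x) \<bullet> u x) / norm (y - x)"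
      if "d > 0" for d
      using that unfolding eventually_at by (simp add: not_less) (meson not_le)
    then have "\<forall>n. \<exists>y. y \<noteq> x \<and> dist y x < inverse (real (Suc n)) \<and>
        e \<le> norm (saddle x y - saddle x x - (y - x) \<bullet> u x) / norm (y - x)"
      by simp
    then obtain y where y: "\<And>n. y n \<noteq> x" "\<And>n. dist (y n) x < inverse (real (Suc n))"
      "\<And>n. e \<le> norm (saddle x (y n) - saddle x x - (y n - x) \<bullet> u x) / norm (y n - x)" by metis
    define h where "h = (\<lambda>n. norm (y n - x))"
    have h_pos: "h n > 0" and h_less: "h n < inverse (real (Suc n))" for n
      using y(1,2)[of n] by (simp_all add: h_def dist_norm)
    have h: "h \<longlonglongrightarrow> 0"
    proof (rule Lim_null_comparison[OF _ LIMSEQ_inverse_real_of_nat])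
      have "norm (h n) \<le> inverse (real (Suc n))" for n using h_pos[of n] h_less[of n] by simp
      then show "\<forall>\<^sub>F n in sequentially. norm (h n) \<le> inverse (real (Suc n))" by simp
    qed
    have "\<exists>p c. (x, p, c) \<in> affine_data \<and> saddle x (y n) < p \<bullet> y n - c + h n / Suc n" for n
    proof -
      have "0 < h n / Suc n" using h_pos[of n] by simp
      then show ?thesis using saddle_approx[OF graph_in_affine_data[OF x]] by metis
    qed
    then obtain p c where pc: "\<And>n. (x, p n, c n) \<in> affine_data"
      and near: "\<And>n. saddle x (y n) < p n \<bullet> y n - c n + h n / Suc n" by metis
    have tangent: "u x \<bullet> (y n - x) \<le> saddle x (y n)" for n using saddle_tangent[OF x] .
    have "\<forall>n. p n \<in> cball 0 M" using affine_data_norm[OF pc] by simp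
    then obtain q r where r: "strict_mono r" and q: "(p \<circ> r) \<longlonglongrightarrow> q"
      using compact_cball[of "0::'a" M] unfolding compact_def by blast
    have hr: "(\<lambda>n. h (r n)) \<longlonglongrightarrow> 0" using LIMSEQ_subseq_LIMSEQ[OF h r] by (simp add: comp_def)
    have "q \<bullet> (z - x) \<le> saddle x z" for z
    proof -
      have "p n \<bullet> (z - x) \<le> saddle x z + (2 * M + 1) * h n" for n
      proof -
        have "(p n - u x) \<bullet> (y n - x) \<le> norm (p n - u x) * h n"
          unfolding h_def by (rule norm_cauchy_schwarz)
        also have "\<dots> \<le> (2 * M) * h n"
          using norm_triangle_ineq4[of "p n" "u x"] affine_data_norm[OF pc[of n]] u_bound[OF x] h_pos[of n]
          by (intro mult_right_mono) auto
        finally have "(p n - u x) \<bullet> (y n - x) \<le> (2 * M) * h n" .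
        moreover have "h n / Suc n \<le> h n" using h_pos[of n] by (simp add: field_simps)
        ultimately show ?thesis
          using affine_data_le_saddle[OF pc[of n], of z] near[of n] tangent[of n]
          by (simp add: inner_diff_left inner_diff_right algebra_simps)
      qed
      then have "(p \<circ> r) n \<bullet> (z - x) \<le> saddle x z + (2 * M + 1) * h (r n)" for n by simp
      moreover have "(\<lambda>n. (p \<circ> r) n \<bullet> (z - x)) \<longlonglongrightarrow> q \<bullet> (z - x)"
        by (intro tendsto_intros q)
      moreover have "(\<lambda>n. saddle x z + (2 * M + 1) * h (r n)) \<longlonglongrightarrow> saddle x z + (2 * M + 1) * 0"
        by (intro tendsto_intros hr)
      ultimately show ?thesis using LIMSEQ_le[of _ "q \<bullet> (z - x)"] by fastforce
    qed
    then have "q = u x" using unique x\<Omega> by (auto simp: subgradients_def)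
    have "e \<le> norm (p n - u x) + inverse (real (Suc n))" for n
    proof -
      have "p n \<bullet> x - c n \<le> 0" using affine_data_le_saddle[OF pc[of n], of x] saddle_diagonal[OF x\<Omega>] by simp
      then have "saddle x (y n) - u x \<bullet> (y n - x) \<le> (p n - u x) \<bullet> (y n - x) + h n / Suc n"
        using near[of n] by (simp add: inner_diff_left inner_diff_right)
      also have "\<dots> \<le> norm (p n - u x) * h n + h n / Suc n"
        unfolding h_def by (intro add_right_mono norm_cauchy_schwarz)
      also have "\<dots> = (norm (p n - u x) + inverse (real (Suc n))) * h n" by (simp add: field_simps)
      finally have "norm (saddle x (y n) - saddle x x - (y n - x) \<bullet> u x) \<le> \<dots>"
        using tangent[of n] saddle_diagonal[OF x\<Omega>] by (simp add: inner_commute)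
      then have "norm (saddle x (y n) - saddle x x - (y n - x) \<bullet> u x) / h n \<le> norm (p n - u x) + inverse (real (Suc n))"
        using h_pos[of n] by (simp add: divide_le_eq)
      then show ?thesis using y(3)[of n] by (simp add: h_def)
    qed
    then have "e \<le> norm ((p \<circ> r) n - u x) + inverse (real (Suc (r n)))" for n by simp
    moreover have "(\<lambda>n. norm ((p \<circ> r) n - u x) + inverse (real (Suc (r n)))) \<longlonglongrightarrow> norm (q - u x) + 0"
      using LIMSEQ_subseq_LIMSEQ[OF LIMSEQ_inverse_real_of_nat r]
      by (intro tendsto_intros q) (simp add: comp_def)
    ultimately have "e \<le> norm (q - u x) + 0"
      by (intro LIMSEQ_le_const) auto
    then show False using e \<open>q = u x\<close> by simp
  qed
  then show ?thesis
    unfolding gderiv_def has_derivative_iff_norm by (auto intro: bounded_linear_inner_left)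
qed

lemma saddle_gderiv_ae: "negligible {x \<in> A. \<not> GDERIV (saddle x) x :> u x}"
proof (rule negligible_subset)
  show "negligible {x. \<exists>p\<in>subgradients x. \<exists>q\<in>subgradients x. p \<noteq> q}"
    by (rule monotone_operator_single_valued_ae) (rule subgradients_monotone)
  have "u x \<in> subgradients x" if "x \<in> A" for x
    using that A_subset saddle_tangent by (auto simp: subgradients_def)
  then show "{x \<in> A. \<not> GDERIV (saddle x) x :> u x} \<subseteq> {x. \<exists>p\<in>subgradients x. \<exists>q\<in>subgradients x. p \<noteq> q}"
    using saddle_gderiv by blast
qed

end

section \<open>Essential points and common translates\<close>

text \<open>
  A weak substitute for Lebesgue's differentiation theorem. An exceptional point is witnessed by a
  pair of basic open sets \<open>V, W\<close> for which the part of \<open>V\<close> that \<open>u\<close> maps into \<open>W\<close> is negligible,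
  and there are only countably many pairs.
\<close>

lemma negligible_inessential_points:
  fixes u :: "'a::euclidean_space \<Rightarrow> 'b::{metric_space, second_countable_topology}"
  shows "negligible {x \<in> \<Omega>. \<exists>e>0. negligible {y \<in> \<Omega>. dist y x < e \<and> dist (u y) (u x) < e}}"
proof -
  obtain V :: "'a set set" where V: "countable V" "topological_basis V"
    using ex_countable_basis by blast
  obtain W :: "'b set set" where W: "countable W" "topological_basis W"
    using ex_countable_basis by blast
  define f where "f = (\<lambda>(v, w). {y \<in> \<Omega>. y \<in> v \<and> u y \<in> w})"
  have "negligible (\<Union>(f ` {vw \<in> V \<times> W. negligible (f vw)}))"
    using V W by (intro negligible_countable_Union countable_image) (auto intro: countable_subset[of _ "V \<times> W"])
  moreover have "{x \<in> \<Omega>. \<exists>e>0. negligible {y \<in> \<Omega>. dist y x < e \<and> dist (u y) (u x) < e}}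
      \<subseteq> \<Union>(f ` {vw \<in> V \<times> W. negligible (f vw)})"
  proof safe
    fix x and e :: real assume x: "x \<in> \<Omega>" and e: "e > 0"
      and negl: "negligible {y \<in> \<Omega>. dist y x < e \<and> dist (u y) (u x) < e}"
    obtain v where v: "v \<in> V" "x \<in> v" "v \<subseteq> ball x e"
      using topological_basisE[OF V(2), of "ball x e" x] e by auto
    obtain w where w: "w \<in> W" "u x \<in> w" "w \<subseteq> ball (u x) e"
      using topological_basisE[OF W(2), of "ball (u x) e" "u x"] e by auto
    have "f (v, w) \<subseteq> {y \<in> \<Omega>. dist y x < e \<and> dist (u y) (u x) < e}"
      using v w by (auto simp: f_def dist_commute subset_iff)
    then have "negligible (f (v, w))" using negl negligible_subset by blast
    moreover have "x \<in> f (v, w)" using v w x by (auto simp: f_def)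
    ultimately show "x \<in> \<Union>(f ` {vw \<in> V \<times> W. negligible (f vw)})" using v w by blast
  qed
  ultimately show ?thesis using negligible_subset by blast
qed

lemma borel_subset_not_negligible:
  assumes "E \<in> sets lebesgue" "\<not> negligible E"
  obtains B where "B \<in> sets borel" "B \<subseteq> E" "emeasure lborel B \<noteq> 0"
proof -
  obtain S K K' where S: "E = S \<union> K" "K \<subseteq> K'" "K' \<in> null_sets lborel" "S \<in> sets lborel"
    using sets_completionE[OF assms(1)] by blast
  have "emeasure lborel S \<noteq> 0"
  proof
    assume "emeasure lborel S = 0"
    then have "S \<in> null_sets lborel" using S by auto
    then have "S \<union> K' \<in> null_sets lebesgue" using S null_sets_completionI by blast
    then have "negligible (S \<union> K')" by (simp add: negligible_iff_null_sets)
    then show False using negligible_subset[of "S \<union> K'" E] assms(2) S(1,2) by blast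
  qed
  then show ?thesis using that[of S] S by auto
qed

lemma negligible_iff_lborel:
  "B \<in> sets borel \<Longrightarrow> negligible B \<longleftrightarrow> emeasure lborel B = 0"
  by (simp add: negligible_iff_null_sets null_sets_def)

text \<open>
  By Tonelli's theorem the measure of \<open>E \<inter> (E' - v)\<close>, integrated over all \<open>v\<close>, is the product of
  the measures of \<open>E\<close> and \<open>E'\<close>, so it cannot vanish for every \<open>v\<close>.
\<close>

lemma translates_meet:
  fixes E E' :: "'a::euclidean_space set"
  assumes "E \<in> sets lebesgue" "\<not> negligible E" "E' \<in> sets lebesgue" "\<not> negligible E'"
  obtains B v where "B \<in> sets borel" "\<not> negligible B" "B \<subseteq> E" "(+) v ` B \<subseteq> E'"
proof -
  obtain C where C: "C \<in> sets borel" "C \<subseteq> E" "emeasure lborel C \<noteq> 0"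
    using borel_subset_not_negligible assms by metis
  obtain C' where C': "C' \<in> sets borel" "C' \<subseteq> E'" "emeasure lborel C' \<noteq> 0"
    using borel_subset_not_negligible assms by metis
  note [measurable] = C(1) C'(1)
  have "\<exists>v. emeasure lborel (C \<inter> (+) v -` C') \<noteq> 0"
  proof (rule ccontr)
    assume *: "\<not> ?thesis"
    \<comment> \<open>Integrating over \<open>x\<close> first gives the measures of the intersections, over \<open>v\<close> first the product.\<close>
    define f :: "'a \<Rightarrow> 'a \<Rightarrow> ennreal" where "f = (\<lambda>x v. indicator C x * indicator C' (v + x))"
    have meas: "case_prod f \<in> borel_measurable (lborel \<Otimes>\<^sub>M lborel)"
      unfolding f_def by measurable
    have "(\<integral>\<^sup>+ v. (\<integral>\<^sup>+ x. f x v \<partial>lborel) \<partial>lborel) = 0"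
    proof -
      have "(\<integral>\<^sup>+ x. f x v \<partial>lborel) = 0" for v
      proof -
        have "(\<integral>\<^sup>+ x. f x v \<partial>lborel) = (\<integral>\<^sup>+ x. indicator (C \<inter> (+) v -` C') x \<partial>lborel)"
          by (intro nn_integral_cong) (auto simp: f_def indicator_def)
        also have "(+) v -` C' \<in> sets borel"
          using measurable_sets_borel[of "(+) v" borel C'] C' by simp
        then have "(\<integral>\<^sup>+ x. indicator (C \<inter> (+) v -` C') x \<partial>lborel) = emeasure lborel (C \<inter> (+) v -` C')"
          using C by (intro nn_integral_indicator) auto
        finally show ?thesis using * by simp
      qed
      then show ?thesis by simp
    qed
    moreover have "(\<integral>\<^sup>+ x. (\<integral>\<^sup>+ v. f x v \<partial>lborel) \<partial>lborel) = emeasure lborel C' * emeasure lborel C"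
    proof -
      have "(\<integral>\<^sup>+ v. f x v \<partial>lborel) = emeasure lborel C' * indicator C x" for x
      proof -
        have "(\<integral>\<^sup>+ v. indicator C' (v + x) \<partial>lborel) = (\<integral>\<^sup>+ v. indicator C' v \<partial>distr lborel borel ((+) x))"
          by (subst nn_integral_distr) (auto simp: add.commute)
        also have "\<dots> = emeasure lborel C'" by (simp add: lborel_distr_plus)
        finally show ?thesis
          unfolding f_def by (subst nn_integral_cmult) (auto simp: mult.commute)
      qed
      then show ?thesis by (simp add: nn_integral_cmult_indicator)
    qed
    ultimately have "emeasure lborel C' * emeasure lborel C = 0"
      using lborel_pair.Fubini'[OF meas] by simp
    then show False using C C' by simp
  qed
  then obtain v where v: "emeasure lborel (C \<inter> (+) v -` C') \<noteq> 0" by blast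
  have B: "C \<inter> (+) v -` C' \<in> sets borel"
    using measurable_sets_borel[of "(+) v" borel C'] C C' by simp
  show ?thesis
    by (rule that[OF B, of v]) (use B v C C' in \<open>auto simp: negligible_iff_lborel\<close>)
qed

lemma common_translates:
  fixes E :: "nat \<Rightarrow> 'a::euclidean_space set"
  assumes "\<And>i. i < k \<Longrightarrow> E i \<in> sets lebesgue" "\<And>i. i < k \<Longrightarrow> \<not> negligible (E i)"
  shows "\<exists>F v. F \<in> sets lebesgue \<and> \<not> negligible F \<and> (\<forall>i<k. (+) (v i) ` F \<subseteq> E i)"
  using assms
proof (induction k)
  case 0
  have "\<not> negligible (UNIV :: 'a set)" by simp
  then show ?case by (intro exI[of _ UNIV]) auto
next
  case (Suc k)
  then obtain F v where F: "F \<in> sets lebesgue" "\<not> negligible F" "\<And>i. i < k \<Longrightarrow> (+) (v i) ` F \<subseteq> E i"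
    by (metis less_Suc_eq)
  obtain B w where B: "B \<in> sets borel" "\<not> negligible B" "B \<subseteq> F" "(+) w ` B \<subseteq> E k"
    using translates_meet[OF F(1,2), of "E k"] Suc.prems by (metis lessI)
  have "(+) ((v(k := w)) i) ` B \<subseteq> E i" if "i < Suc k" for i
    using that B F(3)[of i] by (cases "i = k") auto
  moreover have "B \<in> sets lebesgue" using B(1) by simp
  ultimately show ?case using B(2) by blast
qed

section \<open>Cyclic permutations of translates\<close>

lemma bij_betw_Suc_mod:
  assumes "0 < N" shows "bij_betw (\<lambda>i. Suc i mod N) {..<N} {..<N}"
proof -
  have "inj_on (\<lambda>i. Suc i mod N) {..<N}"
    by (auto intro!: inj_onI simp: mod_Suc split: if_splits)
  moreover have "(\<lambda>i. Suc i mod N) ` {..<N} \<subseteq> {..<N}" using assms by auto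
  ultimately show ?thesis by (simp add: bij_betw_def endo_inj_surj)
qed

lemma sum_Suc_mod: "0 < N \<Longrightarrow> (\<Sum>i<N. f (Suc i mod N)) = (\<Sum>i<N. f i)"
  by (rule sum.reindex_bij_betw[OF bij_betw_Suc_mod])

lemma emeasure_lebesgue_translation: "emeasure lebesgue ((+) a ` S) = emeasure lebesgue S"
  using emeasure_lebesgue_affine[of 1 a S] by (simp cong: image_cong_simp add: add.commute)

text \<open>
  The translate \<open>v i + F\<close> is moved onto the next one; the index is determined uniquely as soon as the
  translates are disjoint.
\<close>

definition cyclic_translation :: "nat \<Rightarrow> 'a::ab_group_add set \<Rightarrow> (nat \<Rightarrow> 'a) \<Rightarrow> 'a \<Rightarrow> 'a" where
  "cyclic_translation N F v x =
     (if \<exists>i<N. x \<in> (+) (v i) ` F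
      then let i = (THE i. i < N \<and> x \<in> (+) (v i) ` F) in x - v i + v (Suc i mod N)
      else x)"

context
  fixes N :: nat and F :: "'a::euclidean_space set" and v :: "nat \<Rightarrow> 'a"
  assumes N: "2 \<le> N" and F: "F \<in> sets lebesgue"
    and inj: "inj_on (\<lambda>(i, y). v i + y) ({..<N} \<times> F)"
begin

lemma translates_disjoint:
  assumes "i < N" "j < N" "x \<in> F" "y \<in> F" "v i + x = v j + y"
  shows "i = j"
  using inj_onD[OF inj, of "(i, x)" "(j, y)"] assms by auto

lemma cyclic_translation_on:
  assumes "i < N" "y \<in> F"
  shows "cyclic_translation N F v (v i + y) = v (Suc i mod N) + y"
proof -
  have "(THE j. j < N \<and> v i + y \<in> (+) (v j) ` F) = i"
    using assms translates_disjoint by (intro the_equality) auto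
  then show ?thesis using assms by (auto simp: cyclic_translation_def Let_def)
qed

lemma cyclic_translation_off:
  "x \<notin> (\<Union>i<N. (+) (v i) ` F) \<Longrightarrow> cyclic_translation N F v x = x"
  by (auto simp: cyclic_translation_def)

lemma cyclic_translation_periodic: "(cyclic_translation N F v ^^ N) x = x"
proof (cases "x \<in> (\<Union>i<N. (+) (v i) ` F)")
  case True
  then obtain i y where i: "i < N" "y \<in> F" "x = v i + y" by auto
  have "(cyclic_translation N F v ^^ k) x = v ((i + k) mod N) + y" for k
    using i N by (induction k) (auto simp: cyclic_translation_on mod_Suc_eq)
  from this[of N] show ?thesis using i by simp
next
  case False
  then have "(cyclic_translation N F v ^^ k) x = x" for k
    by (induction k) (auto simp: cyclic_translation_off)
  then show ?thesis .
qed

lemma cyclic_translation_vimage: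
  "cyclic_translation N F v -` B =
     (B - (\<Union>i<N. (+) (v i) ` F)) \<union> (\<Union>i<N. (+) (v i) ` (F \<inter> (+) (v (Suc i mod N)) -` B))"
  (is "_ = ?R")
proof (rule set_eqI)
  fix x
  show "x \<in> cyclic_translation N F v -` B \<longleftrightarrow> x \<in> ?R"
  proof (cases "x \<in> (\<Union>i<N. (+) (v i) ` F)")
    case True
    then obtain i y where i: "i < N" "y \<in> F" "x = v i + y" by auto
    have "x \<in> ?R \<longleftrightarrow> v (Suc i mod N) + y \<in> B"
    proof
      assume "x \<in> ?R"
      then obtain j z where "j < N" "z \<in> F" "x = v j + z" "v (Suc j mod N) + z \<in> B" using i by blast
      moreover from this have "j = i" using translates_disjoint[of i j y z] i by simp
      ultimately show "v (Suc i mod N) + y \<in> B" using i by simp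
    qed (use i in auto)
    then show ?thesis using i cyclic_translation_on by simp
  next
    case False
    then show ?thesis using cyclic_translation_off by auto
  qed
qed

text \<open>
  The choice \<open>\<tau> i = i\<close> describes \<open>B\<close> itself and \<open>\<tau> i = Suc i mod N\<close> its preimage under the cyclic
  translation.
\<close>

lemma rearranged_set_measure:
  fixes \<tau> :: "nat \<Rightarrow> nat"
  assumes B: "B \<in> sets lebesgue"
  defines "R \<equiv> (B - (\<Union>i<N. (+) (v i) ` F)) \<union> (\<Union>i<N. (+) (v i) ` (F \<inter> (+) (v (\<tau> i)) -` B))"
  shows "R \<in> sets lebesgue"
    and "emeasure lebesgue R = emeasure lebesgue (B - (\<Union>i<N. (+) (v i) ` F))
      + (\<Sum>i<N. emeasure lebesgue (F \<inter> (+) (v (\<tau> i)) -` B))"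
proof -
  have pre: "(+) a -` B \<in> sets lebesgue" for a
  proof -
    have "(+) a -` B = (+) (- a) ` B" by (auto simp: image_iff algebra_simps intro: exI[of _ "a + _"])
    then show ?thesis by (simp only: lebesgue_sets_translation[OF B])
  qed
  have P: "(+) (v i) ` (F \<inter> (+) (v (\<tau> i)) -` B) \<in> sets lebesgue" for i
    using F pre by (intro lebesgue_sets_translation) auto
  have U: "(\<Union>i<N. (+) (v i) ` F) \<in> sets lebesgue"
    using F by (intro sets.finite_UN lebesgue_sets_translation) auto
  have PU: "(\<Union>i<N. (+) (v i) ` (F \<inter> (+) (v (\<tau> i)) -` B)) \<in> sets lebesgue"
    using P by (intro sets.finite_UN) auto
  show "R \<in> sets lebesgue" unfolding R_def by (intro sets.Un sets.Diff B U PU)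
  have "emeasure lebesgue R = emeasure lebesgue (B - (\<Union>i<N. (+) (v i) ` F))
      + emeasure lebesgue (\<Union>i<N. (+) (v i) ` (F \<inter> (+) (v (\<tau> i)) -` B))"
    unfolding R_def by (intro plus_emeasure[symmetric] sets.Diff B U PU) auto
  also have "emeasure lebesgue (\<Union>i<N. (+) (v i) ` (F \<inter> (+) (v (\<tau> i)) -` B))
      = (\<Sum>i<N. emeasure lebesgue ((+) (v i) ` (F \<inter> (+) (v (\<tau> i)) -` B)))"
  proof (rule sum_emeasure[symmetric])
    show "disjoint_family_on (\<lambda>i. (+) (v i) ` (F \<inter> (+) (v (\<tau> i)) -` B)) {..<N}"
      unfolding disjoint_family_on_def using translates_disjoint by fastforce
  qed (use P in auto)
  finally show "emeasure lebesgue R = emeasure lebesgue (B - (\<Union>i<N. (+) (v i) ` F))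
      + (\<Sum>i<N. emeasure lebesgue (F \<inter> (+) (v (\<tau> i)) -` B))"
    by (simp add: emeasure_lebesgue_translation)
qed

text \<open>
  Both \<open>B\<close> and its preimage split into the part outside the translates of \<open>F\<close> and \<open>N\<close> translated
  pieces of \<open>F\<close>; the two families of pieces differ only by the cyclic permutation of the indices.
\<close>

lemma cyclic_translation_vimage_measure:
  assumes B: "B \<in> sets lebesgue"
  shows "cyclic_translation N F v -` B \<in> sets lebesgue"
    and "emeasure lebesgue (cyclic_translation N F v -` B) = emeasure lebesgue B"
proof -
  show "cyclic_translation N F v -` B \<in> sets lebesgue"
    unfolding cyclic_translation_vimage by (rule rearranged_set_measure[OF B])
  have "B = (B - (\<Union>i<N. (+) (v i) ` F)) \<union> (\<Union>i<N. (+) (v i) ` (F \<inter> (+) (v i) -` B))" by auto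
  then have "emeasure lebesgue B = emeasure lebesgue (B - (\<Union>i<N. (+) (v i) ` F))
      + (\<Sum>i<N. emeasure lebesgue (F \<inter> (+) (v i) -` B))"
    using rearranged_set_measure(2)[OF B, of "\<lambda>i. i"] by simp
  also have "\<dots> = emeasure lebesgue (cyclic_translation N F v -` B)"
    unfolding cyclic_translation_vimage rearranged_set_measure(2)[OF B]
    using N by (simp add: sum_Suc_mod[of N "\<lambda>i. emeasure lebesgue (F \<inter> (+) (v i) -` B)"])
  finally show "emeasure lebesgue (cyclic_translation N F v -` B) = emeasure lebesgue B" ..
qed

end

section \<open>The polar condition implies cyclic monotonicity\<close>

locale vector_field_on_domain =
  fixes N :: nat and \<Omega> :: "'a::euclidean_space set" and u :: "'a \<Rightarrow> 'a" and M R :: real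
    and \<mu> :: "'a measure"
  assumes N: "2 \<le> N"
    and nonempty: "\<Omega> \<noteq> {}" and open_domain: "open \<Omega>" and convex_domain: "convex \<Omega>"
    and norm_domain: "\<And>x. x \<in> \<Omega> \<Longrightarrow> norm x \<le> R"
    and mu_def: "\<mu> = normalized_lebesgue_on \<Omega>"
    and u_measurable: "u \<in> borel_measurable (lebesgue_on \<Omega>)"
    and norm_u: "\<And>x. x \<in> \<Omega> \<Longrightarrow> norm (u x) \<le> M"
begin

lemma R_nonneg: "0 \<le> R" and M_nonneg: "0 \<le> M"
  using nonempty norm_domain norm_u by (auto intro: order_trans[OF norm_ge_zero])

lemma domain_sets: "\<Omega> \<in> sets lebesgue"
  using open_domain by (simp add: borel_open)

lemma bounded_domain: "bounded \<Omega>"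
  using norm_domain by (auto simp: bounded_iff)

lemma emeasure_domain: "emeasure lebesgue \<Omega> \<noteq> 0" "emeasure lebesgue \<Omega> \<noteq> \<infinity>"
proof -
  show "emeasure lebesgue \<Omega> \<noteq> 0"
    using open_not_negligible[OF open_domain nonempty] domain_sets
    by (auto simp: negligible_iff_null_sets null_sets_def)
  have "\<Omega> \<in> lmeasurable"
    using bounded_domain domain_sets bounded_set_imp_lmeasurable by blast
  then show "emeasure lebesgue \<Omega> \<noteq> \<infinity>" by (auto simp: fmeasurable_def)
qed

lemma space_mu: "space \<mu> = \<Omega>"
  by (simp add: mu_def normalized_lebesgue_on_def)

lemma sets_mu_eq: "sets \<mu> = sets (lebesgue_on \<Omega>)"
  by (simp add: mu_def normalized_lebesgue_on_def)

lemma in_sets_mu: "B \<in> sets \<mu> \<longleftrightarrow> B \<subseteq> \<Omega> \<and> B \<in> sets lebesgue"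
  using domain_sets by (auto simp: sets_mu_eq sets_restrict_space_iff)

lemma emeasure_mu: "B \<in> sets \<mu> \<Longrightarrow> emeasure \<mu> B = emeasure lebesgue B / emeasure lebesgue \<Omega>"
  using domain_sets unfolding mu_def normalized_lebesgue_on_def
  by (subst emeasure_uniform_measure)
     (auto simp: sets_restrict_space_iff emeasure_restrict_space Int_absorb1)

lemma prob_space_mu: "prob_space \<mu>"
  unfolding mu_def normalized_lebesgue_on_def
  using emeasure_domain domain_sets
  by (intro prob_space_uniform_measure) (auto simp: emeasure_restrict_space)

sublocale prob_space \<mu> by (rule prob_space_mu)

lemma AE_mu_iff: "(AE x in \<mu>. P x) \<longleftrightarrow> negligible {x \<in> \<Omega>. \<not> P x}"
proof -
  have "(AE x in \<mu>. P x) \<longleftrightarrow> (AE x in lebesgue_on \<Omega>. x \<in> \<Omega> \<longrightarrow> P x)"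
    unfolding mu_def normalized_lebesgue_on_def
    using emeasure_domain domain_sets
    by (intro AE_uniform_measure) (auto simp: emeasure_restrict_space top.not_eq_extremum)
  also have "\<dots> \<longleftrightarrow> (AE x in lebesgue. x \<in> \<Omega> \<longrightarrow> P x)"
    using domain_sets by (subst AE_restrict_space_iff) auto
  also have "\<dots> \<longleftrightarrow> negligible {x \<in> \<Omega>. \<not> P x}"
  proof
    assume "AE x in lebesgue. x \<in> \<Omega> \<longrightarrow> P x"
    then obtain K where "K \<in> null_sets lebesgue" "{x \<in> \<Omega>. \<not> P x} \<subseteq> K"
      by (auto simp: eventually_ae_filter)
    then show "negligible {x \<in> \<Omega>. \<not> P x}"
      using negligible_iff_null_sets negligible_subset by blast
  next
    assume "negligible {x \<in> \<Omega>. \<not> P x}"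
    then show "AE x in lebesgue. x \<in> \<Omega> \<longrightarrow> P x"
      by (intro AE_I'[of "{x \<in> \<Omega>. \<not> P x}"]) (auto simp: negligible_iff_null_sets)
  qed
  finally show ?thesis .
qed

lemma measurable_mu: "measurable \<mu> X = measurable (lebesgue_on \<Omega>) X"
  using sets_mu_eq measurable_cong_sets by blast

lemma u_measurable_mu [measurable]: "u \<in> borel_measurable \<mu>"
  using u_measurable by (simp add: measurable_mu)

lemma id_measurable_mu [measurable]: "(\<lambda>x. x) \<in> borel_measurable \<mu>"
  using id_borel_measurable_lebesgue_on[of \<Omega>] by (simp add: measurable_mu id_def)

lemma N_involutions_measurable: "S \<in> N_involutions N \<mu> \<Longrightarrow> S \<in> measurable \<mu> \<mu>"
  by (simp add: N_involutions_def measure_preserving_maps_def)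

lemma N_involutions_borel: "S \<in> N_involutions N \<mu> \<Longrightarrow> S \<in> borel_measurable \<mu>"
  using measurable_comp[OF N_involutions_measurable id_measurable_mu] by (simp add: comp_def)

lemma N_involutions_in_domain: "S \<in> N_involutions N \<mu> \<Longrightarrow> x \<in> \<Omega> \<Longrightarrow> S x \<in> \<Omega>"
  using N_involutions_measurable measurable_space space_mu by metis

lemma id_involution: "id \<in> N_involutions N \<mu>"
proof -
  have "(id ^^ N :: 'a \<Rightarrow> 'a) = id" by (induction N) auto
  then show ?thesis by (simp add: N_involutions_def measure_preserving_maps_def distr_id id_def)
qed

lemma integrable_inner_involution:
  assumes "S \<in> N_involutions N \<mu>"
  shows "integrable \<mu> (\<lambda>x. u x \<bullet> S x)"
proof (rule integrable_const_bound)
  show "AE x in \<mu>. norm (u x \<bullet> S x) \<le> M * R"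
  proof (rule AE_I2)
    fix x assume "x \<in> space \<mu>"
    then have "norm (u x) * norm (S x) \<le> M * R"
      using norm_u norm_domain N_involutions_in_domain[OF assms] M_nonneg by (intro mult_mono) (auto simp: space_mu)
    then show "norm (u x \<bullet> S x) \<le> M * R" using Cauchy_Schwarz_ineq2[of "u x" "S x"] by simp
  qed
  show "(\<lambda>x. u x \<bullet> S x) \<in> borel_measurable \<mu>"
    using N_involutions_borel[OF assms] by (intro borel_measurable_inner) auto
qed

lemma integrable_inner_self: "integrable \<mu> (\<lambda>x. u x \<bullet> x)"
  using integrable_inner_involution[OF id_involution] by simp

lemma integral_inner_diff:
  assumes "S \<in> N_involutions N \<mu>"
  shows "(\<integral>x. u x \<bullet> (x - S x) \<partial>\<mu>) = (\<integral>x. u x \<bullet> x \<partial>\<mu>) - (\<integral>x. u x \<bullet> S x \<partial>\<mu>)"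
  using integrable_inner_self integrable_inner_involution[OF assms] by (simp add: inner_diff_right)

text \<open>
  This transfers cyclic inequalities to nearby points: from the sets permuted by a test map to their
  centres, and from distinct points to cycles with repetitions.
\<close>

lemma cyclic_term_estimate:
  assumes "x \<in> \<Omega>" "y \<in> \<Omega>" "y' \<in> \<Omega>"
    and "norm (y - x) \<le> r" "norm (y' - x') \<le> r" "norm (u y - u x) \<le> r"
  shows "u y \<bullet> (y - y') \<le> u x \<bullet> (x - x') + (2 * R + 2 * M) * r"
proof -
  have r: "0 \<le> r" using assms(4) norm_ge_zero order_trans by blast
  have "u y \<bullet> (y - y') - u x \<bullet> (x - x') = (u y - u x) \<bullet> (y - y') + u x \<bullet> ((y - x) - (y' - x'))"
    by (simp add: inner_diff_left inner_diff_right)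
  moreover have "(u y - u x) \<bullet> (y - y') \<le> r * (2 * R)"
  proof -
    have "(u y - u x) \<bullet> (y - y') \<le> norm (u y - u x) * norm (y - y')" by (rule norm_cauchy_schwarz)
    also have "\<dots> \<le> r * (2 * R)"
      using assms norm_domain[of y] norm_domain[of y'] norm_triangle_ineq4[of y y'] r by (intro mult_mono) auto
    finally show ?thesis .
  qed
  moreover have "u x \<bullet> ((y - x) - (y' - x')) \<le> M * (2 * r)"
  proof -
    have "u x \<bullet> ((y - x) - (y' - x')) \<le> norm (u x) * norm ((y - x) - (y' - x'))" by (rule norm_cauchy_schwarz)
    also have "\<dots> \<le> M * (2 * r)"
      using assms norm_u[of x] norm_triangle_ineq4[of "y - x" "y' - x'"] M_nonneg by (intro mult_mono) auto
    finally show ?thesis .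
  qed
  ultimately show ?thesis by (simp add: algebra_simps)
qed

definition essential_points :: "'a set" where
  "essential_points = {x \<in> \<Omega>. \<forall>e>0. \<not> negligible {y \<in> \<Omega>. dist y x < e \<and> dist (u y) (u x) < e}}"

lemma negligible_not_essential: "negligible (\<Omega> - essential_points)"
  by (rule negligible_subset[OF negligible_inessential_points[of \<Omega> u]]) (auto simp: essential_points_def)

lemma near_values_sets: "{y \<in> \<Omega>. dist y x < e \<and> dist (u y) c < e} \<in> sets lebesgue"
proof -
  have "{y \<in> space \<mu>. dist y x < e \<and> dist (u y) c < e} \<in> sets \<mu>" by measurable
  then show ?thesis by (simp add: in_sets_mu space_mu)
qed

lemma cyclic_translation_involution:
  assumes "F \<in> sets lebesgue" "\<And>i. i < N \<Longrightarrow> (+) (v i) ` F \<subseteq> \<Omega>"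
    and "inj_on (\<lambda>(i, y). v i + y) ({..<N} \<times> F)"
  shows "cyclic_translation N F v \<in> N_involutions N \<mu>"
proof -
  let ?S = "cyclic_translation N F v"
  note facts = cyclic_translation_on[OF N assms(1,3)] cyclic_translation_off[OF N assms(1,3)]
  have into: "?S x \<in> \<Omega>" if "x \<in> \<Omega>" for x
  proof (cases "x \<in> (\<Union>i<N. (+) (v i) ` F)")
    case True
    then obtain i y where i: "i < N" "y \<in> F" "x = v i + y" by auto
    then show ?thesis using facts(1)[OF i(1,2)] assms(2)[of "Suc i mod N"] N by auto
  next
    case False
    then show ?thesis using facts(2)[OF False] that by simp
  qed
  have sub: "?S -` B \<subseteq> \<Omega>" if "B \<subseteq> \<Omega>" for B
  proof
    fix x assume x: "x \<in> ?S -` B"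
    show "x \<in> \<Omega>"
    proof (cases "x \<in> (\<Union>i<N. (+) (v i) ` F)")
      case True then show ?thesis using assms(2) by auto
    next
      case False
      then have "?S x = x" by (auto simp: cyclic_translation_def)
      then show ?thesis using x that by auto
    qed
  qed
  have pre: "?S -` B \<inter> space \<mu> \<in> sets \<mu> \<and> emeasure \<mu> (?S -` B \<inter> space \<mu>) = emeasure \<mu> B" if "B \<in> sets \<mu>" for B
  proof -
    have B: "B \<in> sets lebesgue" "B \<subseteq> \<Omega>" using that by (auto simp: in_sets_mu)
    have "?S -` B \<inter> space \<mu> = ?S -` B" using sub B by (auto simp: space_mu)
    moreover have "?S -` B \<in> sets \<mu>"
      using sub B cyclic_translation_vimage_measure(1)[OF N assms(1,3) B(1)] by (simp add: in_sets_mu)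
    ultimately show ?thesis
      using that cyclic_translation_vimage_measure(2)[OF N assms(1,3) B(1)] by (simp add: emeasure_mu)
  qed
  have meas: "?S \<in> measurable \<mu> \<mu>"
    using pre into by (auto simp: measurable_def space_mu)
  have "distr \<mu> \<mu> ?S = \<mu>"
    by (rule measure_eqI) (use pre meas in \<open>auto simp: emeasure_distr\<close>)
  moreover have "AE x in \<mu>. (?S ^^ N) x = x"
    using cyclic_translation_periodic[OF N assms(1,3)] by simp
  ultimately show ?thesis using meas by (simp add: N_involutions_def measure_preserving_maps_def)
qed

text \<open>
  The test map translates cyclically \<open>N\<close> copies of one set \<open>F\<close>, the \<open>i\<close>-th lying in the set of points
  near \<open>x i\<close> where \<open>u\<close> is near \<open>u (x i)\<close>. All copies have the same measure \<open>m > 0\<close>, so the polar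
  condition is \<open>m\<close> times the desired inequality up to an error of order \<open>r\<close>.
\<close>

lemma polar_imp_cyclic_inequality:
  assumes polar: "\<And>S. S \<in> N_involutions N \<mu> \<Longrightarrow> 0 \<le> (\<integral>x. u x \<bullet> (x - S x) \<partial>\<mu>)"
    and x: "\<And>i. i < N \<Longrightarrow> x i \<in> essential_points" and inj: "inj_on x {..<N}"
  shows "0 \<le> (\<Sum>i<N. u (x i) \<bullet> (x i - x (Suc i mod N)))"
proof (rule field_le_epsilon)
  fix e :: real assume e: "e > 0"
  have x\<Omega>: "x i \<in> \<Omega>" if "i < N" for i using x[OF that] by (simp add: essential_points_def)
  define C where "C = 2 * R + 2 * M + 1"
  have C: "C > 0" using R_nonneg M_nonneg by (simp add: C_def)
  define r0 where "r0 = Min ((\<lambda>(i, j). dist (x i) (x j)) ` {(i, j). i < N \<and> j < N \<and> i \<noteq> j})"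
  have fin: "finite {(i, j). i < N \<and> j < N \<and> i \<noteq> j}"
    by (rule finite_subset[of _ "{..<N} \<times> {..<N}"]) auto
  have "(0, 1) \<in> {(i, j). i < N \<and> j < N \<and> i \<noteq> j}" using N by auto
  then have ne: "{(i, j). i < N \<and> j < N \<and> i \<noteq> j} \<noteq> {}" by blast
  have r0: "r0 > 0" unfolding r0_def
    using fin ne inj by (subst Min_gr_iff) (auto dest: inj_onD)
  have r0_le: "r0 \<le> dist (x i) (x j)" if "i < N" "j < N" "i \<noteq> j" for i j
    unfolding r0_def using fin that by (intro Min_le) auto
  \<comment> \<open>The first bound makes the neighbourhoods of the \<open>x i\<close> disjoint, the second makes the total error at most \<open>e\<close>.\<close>
  define r where "r = min (r0 / 2) (e / (N * C))"
  have r: "r > 0" "2 * r \<le> r0" "N * C * r \<le> e"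
  proof -
    show "r > 0" "2 * r \<le> r0" using r0 e C N by (auto simp: r_def)
    have "N * C * r \<le> N * C * (e / (N * C))" using C by (intro mult_left_mono) (auto simp: r_def)
    then show "N * C * r \<le> e" using C N by simp
  qed
  define E where "E = (\<lambda>i. {y \<in> \<Omega>. dist y (x i) < r \<and> dist (u y) (u (x i)) < r})"
  have "E i \<in> sets lebesgue" for i unfolding E_def by (rule near_values_sets)
  moreover have "\<not> negligible (E i)" if "i < N" for i
    using x[OF that] r(1) by (auto simp: E_def essential_points_def)
  ultimately obtain F v where F: "F \<in> sets lebesgue" "\<not> negligible F" "\<And>i. i < N \<Longrightarrow> (+) (v i) ` F \<subseteq> E i"
    using common_translates[of N E] by metis
  have FE: "v i + y \<in> E i" if "i < N" "y \<in> F" for i y using F(3) that by auto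
  have disj: "i = j" if "i < N" "j < N" "y \<in> F" "z \<in> F" "v i + y = v j + z" for i j y z
  proof (rule ccontr)
    assume "i \<noteq> j"
    have "dist (v i + y) (x i) < r" "dist (v i + y) (x j) < r"
      using FE[OF that(1,3)] FE[OF that(2,4)] that(5) by (auto simp: E_def)
    then have "dist (x i) (x j) < 2 * r"
      using dist_triangle[of "x i" "x j" "v i + y"] by (simp add: dist_commute)
    then show False using r0_le[OF that(1,2) \<open>i \<noteq> j\<close>] r by simp
  qed
  have inj_F: "inj_on (\<lambda>(i, y). v i + y) ({..<N} \<times> F)"
    using disj by (fastforce simp: inj_on_def)
  define S where "S = cyclic_translation N F v"
  have S: "S \<in> N_involutions N \<mu>" unfolding S_def
    using F inj_F by (intro cyclic_translation_involution) (auto simp: E_def)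
  define P where "P = (\<lambda>i. (+) (v i) ` F)"
  have P: "P i \<in> sets \<mu>" if "i < N" for i
    using F lebesgue_sets_translation[OF F(1)] that by (auto simp: P_def in_sets_mu E_def)
  define m where "m = measure \<mu> (P 0)"
  have measure_P: "measure \<mu> (P i) = m" if "i < N" for i
  proof -
    have "emeasure \<mu> (P i) = emeasure \<mu> (P 0)"
      using P[OF that] P[of 0] N by (simp add: emeasure_mu) (simp add: P_def emeasure_lebesgue_translation)
    then show ?thesis by (simp add: m_def measure_def)
  qed
  have m: "m > 0"
  proof -
    have "emeasure lebesgue (P 0) \<noteq> 0"
      using F(1,2) by (auto simp: P_def emeasure_lebesgue_translation negligible_iff_null_sets null_sets_def)
    then have "emeasure \<mu> (P 0) \<noteq> 0"
      using P[of 0] N emeasure_domain by (simp add: emeasure_mu ennreal_divide_eq_0_iff)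
    then show ?thesis unfolding m_def by (simp add: emeasure_eq_measure zero_less_measure_iff)
  qed
  define a where "a = (\<lambda>i. u (x i) \<bullet> (x i - x (Suc i mod N)))"
  have bound: "u z \<bullet> (z - S z) \<le> (\<Sum>i<N. (a i + C * r) * indicator (P i) z)" for z
  proof (cases "\<exists>i<N. z \<in> P i")
    case True
    then obtain i y where i: "i < N" "y \<in> F" "z = v i + y" by (auto simp: P_def)
    have Sz: "S z = v (Suc i mod N) + y"
      unfolding S_def i(3) using cyclic_translation_on[OF N F(1) inj_F i(1,2)] by simp
    have si: "Suc i mod N < N" using N by simp
    have "u z \<bullet> (z - S z) \<le> a i + (2 * R + 2 * M) * r" unfolding a_def Sz
      using FE[OF i(1,2)] FE[OF si i(2)] x\<Omega>[OF i(1)] i(3)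
      by (intro cyclic_term_estimate) (auto simp: E_def dist_norm)
    also have "\<dots> \<le> a i + C * r" using r by (simp add: C_def algebra_simps)
    also have "\<dots> = (\<Sum>j\<in>{i}. (a j + C * r) * indicator (P j) z)" using i by (simp add: P_def)
    also have "\<dots> = (\<Sum>j<N. (a j + C * r) * indicator (P j) z)"
      using i disj by (intro sum.mono_neutral_left) (auto simp: P_def indicator_def)
    finally show ?thesis .
  next
    case False
    then have "S z = z" unfolding S_def cyclic_translation_def by (auto simp: P_def)
    then show ?thesis using False by (auto intro!: sum_nonneg)
  qed
  have "0 \<le> (\<integral>z. u z \<bullet> (z - S z) \<partial>\<mu>)" by (rule polar[OF S])
  also have "\<dots> \<le> (\<integral>z. (\<Sum>i<N. (a i + C * r) * indicator (P i) z) \<partial>\<mu>)"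
  proof (rule integral_mono)
    show "integrable \<mu> (\<lambda>z. u z \<bullet> (z - S z))"
      using integrable_inner_self integrable_inner_involution[OF S] by (simp add: inner_diff_right)
    show "integrable \<mu> (\<lambda>z. \<Sum>i<N. (a i + C * r) * indicator (P i) z)"
      using P by (intro Bochner_Integration.integrable_sum integrable_mult_right integrable_real_indicator)
        (auto simp: emeasure_eq_measure)
  qed (rule bound)
  also have "\<dots> = (\<Sum>i<N. (a i + C * r) * m)"
    using P measure_P by (subst Bochner_Integration.integral_sum) (auto simp: emeasure_eq_measure P_def
        intro!: sum.cong)
  also have "\<dots> = m * ((\<Sum>i<N. a i) + N * C * r)"
    by (simp add: sum.distrib algebra_simps sum_distrib_left sum_distrib_right[symmetric])
  finally have "0 \<le> (\<Sum>i<N. a i) + N * C * r" using m by (simp add: zero_le_mult_iff)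
  then show "0 \<le> (\<Sum>i<N. u (x i) \<bullet> (x i - x (Suc i mod N))) + e" using r by (simp add: a_def)
qed

text \<open>
  The test maps need disjoint sets, so the points of a cycle must be made distinct. A set that is not
  negligible stays nonempty after removal of a negligible set and of the points chosen before.
\<close>

lemma essential_points_distinct_approximation:
  fixes k :: nat
  assumes x: "\<And>i. i < k \<Longrightarrow> x i \<in> essential_points" and e: "e > 0"
  shows "\<exists>y. inj_on y {..<k} \<and>
    (\<forall>i<k. y i \<in> essential_points \<and> norm (y i - x i) \<le> e \<and> norm (u (y i) - u (x i)) \<le> e)"
  using x
proof (induction k)
  case 0
  then show ?case by simp
next
  case (Suc k)
  then obtain y where y: "inj_on y {..<k}"
    "\<And>i. i < k \<Longrightarrow> y i \<in> essential_points \<and> norm (y i - x i) \<le> e \<and> norm (u (y i) - u (x i)) \<le> e"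
    by (metis less_Suc_eq)
  define E where "E = {y \<in> \<Omega>. dist y (x k) < e \<and> dist (u y) (u (x k)) < e}"
  have "\<not> negligible E"
    using Suc.prems[of k] e by (auto simp: E_def essential_points_def)
  moreover have "negligible ((\<Omega> - essential_points) \<union> y ` {..<k})"
    using negligible_not_essential negligible_finite[of "y ` {..<k}"] by (intro negligible_Un) auto
  ultimately obtain z where z: "z \<in> E" "z \<notin> (\<Omega> - essential_points) \<union> y ` {..<k}"
    using negligible_subset by blast
  have "inj_on (y(k := z)) {..<Suc k}"
    using y(1) z(2) by (auto simp: inj_on_def less_Suc_eq)
  moreover have "(y(k := z)) i \<in> essential_points \<and> norm ((y(k := z)) i - x i) \<le> e \<and>
      norm (u ((y(k := z)) i) - u (x i)) \<le> e" if "i < Suc k" for i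
    using y(2)[of i] z that by (cases "i = k") (auto simp: E_def dist_norm)
  ultimately show ?case by blast
qed

lemma polar_imp_cyclically_monotone:
  assumes polar: "\<And>S. S \<in> N_involutions N \<mu> \<Longrightarrow> 0 \<le> (\<integral>x. u x \<bullet> (x - S x) \<partial>\<mu>)"
  shows "cyclically_monotone_on N essential_points u"
  unfolding cyclically_monotone_on_def
proof
  fix x assume x: "x \<in> {..<N} \<rightarrow>\<^sub>E essential_points"
  have ess\<Omega>: "z \<in> \<Omega>" if "z \<in> essential_points" for z using that by (simp add: essential_points_def)
  show "0 \<le> (\<Sum>i<N. u (x i) \<bullet> (x i - x (Suc i mod N)))"
  proof (rule field_le_epsilon)
    fix e :: real assume e: "e > 0"
    define C where "C = 2 * R + 2 * M + 1"
    have C: "C > 0" using R_nonneg M_nonneg by (simp add: C_def)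
    define r where "r = e / (N * C)"
    have r: "r > 0" "N * C * r = e" using e C N by (auto simp: r_def)
    obtain y where y: "inj_on y {..<N}"
      "\<And>i. i < N \<Longrightarrow> y i \<in> essential_points \<and> norm (y i - x i) \<le> r \<and> norm (u (y i) - u (x i)) \<le> r"
      using essential_points_distinct_approximation[of N x r] x r(1) by (auto simp: PiE_iff)
    have "0 \<le> (\<Sum>i<N. u (y i) \<bullet> (y i - y (Suc i mod N)))"
      using polar_imp_cyclic_inequality[OF polar _ y(1)] y(2) by blast
    also have "\<dots> \<le> (\<Sum>i<N. u (x i) \<bullet> (x i - x (Suc i mod N)) + C * r)"
    proof (rule sum_mono)
      fix i assume "i \<in> {..<N}"
      then have i: "i < N" "Suc i mod N < N" by auto
      have "u (y i) \<bullet> (y i - y (Suc i mod N)) \<le> u (x i) \<bullet> (x i - x (Suc i mod N)) + (2 * R + 2 * M) * r"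
        using y(2)[OF i(1)] y(2)[OF i(2)] x i by (intro cyclic_term_estimate) (auto intro: ess\<Omega>)
      then show "u (y i) \<bullet> (y i - y (Suc i mod N)) \<le> u (x i) \<bullet> (x i - x (Suc i mod N)) + C * r"
        using r by (simp add: C_def algebra_simps)
    qed
    also have "\<dots> = (\<Sum>i<N. u (x i) \<bullet> (x i - x (Suc i mod N))) + e"
      using r(2) by (simp add: sum.distrib)
    finally show "0 \<le> (\<Sum>i<N. u (x i) \<bullet> (x i - x (Suc i mod N))) + e" .
  qed
qed

end

section \<open>Integrals of extended real functions, cyclic sums and tangents\<close>

lemma INF_eq_value_iff:
  fixes g :: "'b \<Rightarrow> 'c::conditionally_complete_lattice"
  assumes "bdd_below (g ` I)" "a \<in> I"
  shows "(INF x\<in>I. g x) = g a \<longleftrightarrow> (\<forall>x\<in>I. g a \<le> g x)"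
proof
  assume "(INF x\<in>I. g x) = g a"
  then show "\<forall>x\<in>I. g a \<le> g x" using cINF_lower[OF assms(1)] by metis
next
  assume "\<forall>x\<in>I. g a \<le> g x"
  then show "(INF x\<in>I. g x) = g a"
    using assms by (intro antisym cINF_lower cINF_greatest) auto
qed

lemma ereal_integral_cong_AE:
  assumes "AE x in M. f x = g x" shows "ereal_integral M f = ereal_integral M g"
proof -
  have "(\<integral>\<^sup>+x. e2ennreal (f x) \<partial>M) = (\<integral>\<^sup>+x. e2ennreal (g x) \<partial>M)"
    by (rule nn_integral_cong_AE) (use assms in auto)
  moreover have "(\<integral>\<^sup>+x. e2ennreal (- f x) \<partial>M) = (\<integral>\<^sup>+x. e2ennreal (- g x) \<partial>M)"
    by (rule nn_integral_cong_AE) (use assms in auto)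
  ultimately show ?thesis by (simp add: ereal_integral_def)
qed

text \<open>
  The Lagrangian is a supremum of uncountably many functions, so no measurability is at hand; but the
  nonnegative integral, which defines both parts, is monotone for arbitrary functions.
\<close>

lemma ereal_integral_mono:
  assumes "\<And>x. x \<in> space M \<Longrightarrow> f x \<le> g x" shows "ereal_integral M f \<le> ereal_integral M g"
proof -
  have "(\<integral>\<^sup>+x. e2ennreal (f x) \<partial>M) \<le> (\<integral>\<^sup>+x. e2ennreal (g x) \<partial>M)"
    by (intro nn_integral_mono e2ennreal_mono assms)
  moreover have "(\<integral>\<^sup>+x. e2ennreal (- g x) \<partial>M) \<le> (\<integral>\<^sup>+x. e2ennreal (- f x) \<partial>M)"
    by (intro nn_integral_mono e2ennreal_mono) (simp add: assms)
  ultimately show ?thesis unfolding ereal_integral_def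
    by (intro ereal_minus_mono) (simp_all add: less_eq_ennreal.rep_eq)
qed

lemma ereal_integral_ereal:
  assumes "integrable M g" shows "ereal_integral M (\<lambda>x. ereal (g x)) = ereal (\<integral>x. g x \<partial>M)"
proof -
  have fin: "(\<integral>\<^sup>+x. ennreal (g x) \<partial>M) \<noteq> \<infinity>" "(\<integral>\<^sup>+x. ennreal (- g x) \<partial>M) \<noteq> \<infinity>"
    using assms by (auto simp: real_integrable_def)
  have conv: "enn2ereal a = ereal (enn2real a)" if "a \<noteq> \<infinity>" for a
    using that by (cases a) auto
  have "ereal_integral M (\<lambda>x. ereal (g x)) =
      enn2ereal (\<integral>\<^sup>+x. ennreal (g x) \<partial>M) - enn2ereal (\<integral>\<^sup>+x. ennreal (- g x) \<partial>M)"
    by (simp add: ereal_integral_def e2ennreal_ereal)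
  also have "\<dots> = ereal (\<integral>x. g x \<partial>M)"
    unfolding real_lebesgue_integral_def[OF assms] conv[OF fin(1)] conv[OF fin(2)] by simp
  finally show ?thesis .
qed

lemma cyclic_shift_funpow:
  "i < N \<Longrightarrow> (cyclic_shift N ^^ k) z i = z ((i + k) mod N)"
  by (induction k arbitrary: i) (auto simp: cyclic_shift_def mod_add_left_eq)

lemma cyclic_sum_shift:
  assumes "0 < N"
  shows "(\<Sum>i<N. F (cyclic_shift N z i) (cyclic_shift N z (Suc i mod N))) = (\<Sum>i<N. F (z i) (z (Suc i mod N)))"
proof -
  have "(\<Sum>i<N. F (cyclic_shift N z i) (cyclic_shift N z (Suc i mod N)))
      = (\<Sum>i<N. F (z (Suc i mod N)) (z (Suc (Suc i mod N) mod N)))"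
    using assms by (intro sum.cong) (auto simp: cyclic_shift_def)
  also have "\<dots> = (\<Sum>i<N. F (z i) (z (Suc i mod N)))"
    by (rule sum_Suc_mod[OF assms, of "\<lambda>i. F (z i) (z (Suc i mod N))"])
  finally show ?thesis .
qed

text \<open>
  The cyclic average is subtracted so that the sum over all shifts vanishes; for a sub-antisymmetric
  \<open>F\<close> this only increases the value.
\<close>

definition antisymmetrization :: "nat \<Rightarrow> ('a \<Rightarrow> 'a \<Rightarrow> real) \<Rightarrow> (nat \<Rightarrow> 'a) \<Rightarrow> real" where
  "antisymmetrization N F z = F (z 0) (z 1) - (\<Sum>i<N. F (z i) (z (Suc i mod N))) / N"

text \<open>
  The subtracted average is invariant under cyclic shifts, and the first terms along the orbit of \<open>z\<close>
  are exactly the summands of the cyclic sum.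
\<close>

lemma antisymmetrization_cyclic_sum:
  assumes "2 \<le> N"
  shows "(\<Sum>k<N. antisymmetrization N F ((cyclic_shift N ^^ k) z)) = 0"
proof -
  define Q where "Q = (\<lambda>z. \<Sum>i<N. F (z i) (z (Suc i mod N)))"
  have Q: "Q ((cyclic_shift N ^^ k) z) = Q z" for k
    using assms by (induction k) (simp_all add: Q_def cyclic_sum_shift)
  have def: "antisymmetrization N F w = F (w 0) (w 1) - Q w / N" for w
    by (simp add: antisymmetrization_def Q_def)
  have "(\<Sum>k<N. antisymmetrization N F ((cyclic_shift N ^^ k) z))
      = (\<Sum>k<N. F (z k) (z (Suc k mod N)) - Q z / N)"
    unfolding def Q using assms by (intro sum.cong) (auto simp: cyclic_shift_funpow)
  also have "\<dots> = 0" using assms by (simp add: sum_subtractf Q_def)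
  finally show ?thesis .
qed

lemma antisymmetrization_ge:
  assumes "cyclically_sub_antisymmetric_on N A F" "z \<in> {..<N} \<rightarrow>\<^sub>E A"
  shows "F (z 0) (z 1) \<le> antisymmetrization N F z"
proof -
  have "(\<Sum>i<N. F (z i) (z (Suc i mod N))) \<le> 0"
    using assms unfolding cyclically_sub_antisymmetric_on_def by blast
  then have "(\<Sum>i<N. F (z i) (z (Suc i mod N))) / N \<le> 0" by (rule divide_nonpos_nonneg) simp
  then show ?thesis unfolding antisymmetrization_def by linarith
qed

lemma antisymmetrization_mem:
  assumes N: "2 \<le> N" and cont: "continuous_on (A \<times> A) (\<lambda>z. F (fst z) (snd z))"
  shows "antisymmetrization N F \<in> cyclically_antisymmetric_functions N A"
proof -
  have "continuous_on ({..<N} \<rightarrow>\<^sub>E A) (\<lambda>z. F (z i) (z j))" if "i < N" "j < N" for i j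
  proof -
    have "continuous_on ({..<N} \<rightarrow>\<^sub>E A) (\<lambda>z. (z i, z j))"
      by (intro continuous_on_Pair continuous_on_subset[OF continuous_on_product_coordinates]) auto
    then show ?thesis
      using continuous_on_compose2[OF cont, of "{..<N} \<rightarrow>\<^sub>E A" "\<lambda>z. (z i, z j)"] that by auto
  qed
  then have "continuous_on ({..<N} \<rightarrow>\<^sub>E A) (antisymmetrization N F)"
    unfolding antisymmetrization_def using N by (intro continuous_intros) auto
  then show ?thesis
    by (simp add: cyclically_antisymmetric_functions_def antisymmetrization_cyclic_sum[OF N])
qed

lemma convex_on_gderiv_tangent:
  assumes f: "convex_on S f" "GDERIV f x :> g" and xy: "x \<in> S" "y \<in> S"
  shows "g \<bullet> (y - x) \<le> f y - f x"
proof -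
  define \<phi> where "\<phi> = (\<lambda>t::real. f (x + t *\<^sub>R (y - x)))"
  have "((\<lambda>t. x + t *\<^sub>R (y - x)) has_derivative (\<lambda>t. t *\<^sub>R (y - x))) (at 0)"
    by (auto intro!: derivative_eq_intros)
  moreover have "(f has_derivative (\<lambda>h. h \<bullet> g)) (at (x + 0 *\<^sub>R (y - x)))"
    using f(2) by (simp add: gderiv_def)
  ultimately have "(\<phi> has_derivative (\<lambda>t. t *\<^sub>R (y - x) \<bullet> g)) (at 0)"
    unfolding \<phi>_def by (rule has_derivative_compose)
  moreover have "(\<lambda>t. t *\<^sub>R (y - x) \<bullet> g) = (*) (g \<bullet> (y - x))"
    by (auto simp: fun_eq_iff inner_commute mult.commute)
  ultimately have "DERIV \<phi> 0 :> g \<bullet> (y - x)"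
    by (simp add: has_field_derivative_def)
  then have "((\<lambda>t. (\<phi> (0 + t) - \<phi> 0) / t) \<longlongrightarrow> g \<bullet> (y - x)) (at 0)"
    by (simp add: DERIV_def)
  then have "((\<lambda>t. (\<phi> (0 + t) - \<phi> 0) / t) \<longlongrightarrow> g \<bullet> (y - x)) (at_right 0)"
    by (rule filterlim_mono) (auto intro: at_le)
  moreover have "\<forall>\<^sub>F t in at_right (0::real). (\<phi> (0 + t) - \<phi> 0) / t \<le> f y - f x"
    using eventually_at_right_real[of 0 1, OF zero_less_one]
  proof eventually_elim
    fix t :: real assume t: "t \<in> {0<..<1}"
    have "\<phi> t = f ((1 - t) *\<^sub>R x + t *\<^sub>R y)" by (simp add: \<phi>_def algebra_simps)
    also have "\<dots> \<le> (1 - t) * f x + t * f y"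
      using convex_onD[OF f(1), of t x y] t xy by simp
    finally have "\<phi> (0 + t) - \<phi> 0 \<le> (f y - f x) * t" by (simp add: \<phi>_def algebra_simps)
    then show "(\<phi> (0 + t) - \<phi> 0) / t \<le> f y - f x" using t by (simp add: pos_divide_le_eq)
  qed
  ultimately show ?thesis by (rule tendsto_upperbound) simp
qed

lemma sum_first_momentum:
  fixes p :: "'a::real_inner"
  assumes "2 \<le> N"
  shows "(\<Sum>i\<in>{1..<N}. ((\<lambda>_. 0)(1 := p)) i \<bullet> y i) = p \<bullet> y (1::nat)"
proof -
  have "(\<Sum>i\<in>{1..<N}. ((\<lambda>_. 0)(1 := p)) i \<bullet> y i) = (\<Sum>i\<in>{1..<N}. if i = 1 then p \<bullet> y i else 0)"
    by (rule sum.cong) simp_all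
  also have "\<dots> = p \<bullet> y 1" using assms by (subst sum.delta) simp_all
  finally show ?thesis .
qed

section \<open>The equivalences with the polar condition\<close>

context vector_field_on_domain
begin

abbreviation "product_space \<equiv> Pi\<^sub>M {..<N} (\<lambda>_. \<mu>)"

lemma component_measurable: "i < N \<Longrightarrow> (\<lambda>x. x i) \<in> measurable product_space \<mu>"
  by (rule measurable_component_singleton) simp

lemma cyclic_term_measurable:
  assumes "i < N" "j < N"
  shows "(\<lambda>x. u (x i) \<bullet> (x i - x j)) \<in> borel_measurable product_space"
proof -
  note [measurable] = component_measurable[OF assms(1)] component_measurable[OF assms(2)]
  have [measurable]: "(\<lambda>x. x i) \<in> borel_measurable product_space" "(\<lambda>x. x j) \<in> borel_measurable product_space"
    using measurable_comp[OF component_measurable[OF assms(1)] id_measurable_mu]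
      measurable_comp[OF component_measurable[OF assms(2)] id_measurable_mu] by (simp_all add: comp_def)
  show ?thesis by measurable
qed

definition transport_cost :: "(nat \<Rightarrow> 'a) measure \<Rightarrow> real" where
  "transport_cost \<pi> = (\<integral>x. u (x 0) \<bullet> (x 0 - x 1) \<partial>\<pi>)"

text \<open>
  Invariance under one cyclic shift gives invariance under all of them. The family \<open>g\<close> is used instead
  of iterates of the shift because the functions of interest read off the coordinate \<open>k\<close> directly.
\<close>

lemma sym_measures_iterate:
  assumes \<pi>: "\<pi> \<in> sym_measures N \<mu>"
    and shift: "\<And>k x. Suc k < N \<Longrightarrow> g k (cyclic_shift N x) = g (Suc k) x"
    and int: "\<And>k. k < N \<Longrightarrow> integrable \<pi> (g k)" and k: "k < N"
  shows "(\<integral>x. g k x \<partial>\<pi>) = (\<integral>x. g 0 x \<partial>\<pi> :: real)"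
  using k
proof (induction k)
  case (Suc k)
  then have "(\<integral>x. g k x \<partial>\<pi>) = (\<integral>x. g k (cyclic_shift N x) \<partial>\<pi>)"
    using \<pi> int[of k] unfolding sym_measures_def by auto
  then show ?case using Suc shift[of k] by simp
qed simp

text \<open>
  Invariance makes every marginal of \<open>\<pi>\<close> vanish on \<open>\<mu>\<close>-null sets, so almost every tuple avoids
  \<open>\<Omega>\<^sub>0\<close> in all coordinates, and it makes the \<open>N\<close> terms of the cyclic sum have equal integrals.
\<close>

lemma sym_measures_nonneg:
  assumes mono: "cyclically_monotone_on N (\<Omega> - \<Omega>\<^sub>0) u" and null: "\<Omega>\<^sub>0 \<in> null_sets lebesgue"
    and \<pi>: "\<pi> \<in> sym_measures N \<mu>"
  shows "0 \<le> transport_cost \<pi>"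
proof -
  interpret \<pi>: prob_space \<pi> using \<pi> by (simp add: sym_measures_def)
  have sets: "sets \<pi> = sets product_space" and marginal: "distr \<pi> \<mu> (\<lambda>x. x 0) = \<mu>"
    using \<pi> by (auto simp: sym_measures_def)
  have space: "space \<pi> = {..<N} \<rightarrow>\<^sub>E \<Omega>"
    using sets_eq_imp_space_eq[OF sets] by (simp add: space_PiM space_mu)
  have meas: "measurable \<pi> X = measurable product_space X" for X :: "'c measure"
    using sets measurable_cong_sets by blast
  have comp: "(\<lambda>x. x i) \<in> measurable \<pi> \<mu>" if "i < N" for i
    using component_measurable[OF that] by (simp add: meas)
  define K where "K = \<Omega> \<inter> \<Omega>\<^sub>0"
  have K: "K \<in> sets \<mu>" "measure \<mu> K = 0"
  proof -
    show *: "K \<in> sets \<mu>" using null domain_sets by (auto simp: K_def in_sets_mu)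
    have "K \<in> null_sets lebesgue" unfolding K_def
      using null unfolding negligible_iff_null_sets[symmetric] by (rule negligible_subset) auto
    then have "emeasure \<mu> K = 0" using * by (simp add: emeasure_mu null_sets_def)
    then show "measure \<mu> K = 0" by (simp add: measure_def)
  qed
  have KI: "{x \<in> space \<pi>. x i \<in> K} \<in> sets \<pi>" if "i < N" for i
    using measurable_sets[OF comp[OF that] K(1)] by (simp add: vimage_def Int_def conj_commute)
  have "AE x in \<pi>. x i \<notin> K" if i: "i < N" for i
  proof -
    define g where "g = (\<lambda>(i::nat) x. indicator K (x i :: 'a) :: real)"
    have g: "integrable \<pi> (g i)" "(\<integral>x. g i x \<partial>\<pi>) = measure \<pi> {x \<in> space \<pi>. x i \<in> K}" if "i < N" for i
    proof -
      have eq: "g i x = indicator {x \<in> space \<pi>. x i \<in> K} x" if "x \<in> space \<pi>" for x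
        using that by (auto simp: g_def indicator_def)
      have "integrable \<pi> (indicator {x \<in> space \<pi>. x i \<in> K} :: _ \<Rightarrow> real)"
        using KI[OF that] by (simp add: integrable_real_indicator \<pi>.emeasure_eq_measure)
      then show "integrable \<pi> (g i)" using eq by (subst Bochner_Integration.integrable_cong[OF refl eq]) auto
      show "(\<integral>x. g i x \<partial>\<pi>) = measure \<pi> {x \<in> space \<pi>. x i \<in> K}"
      proof -
        have "{x \<in> space \<pi>. x i \<in> K} \<inter> space \<pi> = {x \<in> space \<pi>. x i \<in> K}" by auto
        then show ?thesis by (subst Bochner_Integration.integral_cong[OF refl eq]) simp_all
      qed
    qed
    have "(\<integral>x. g i x \<partial>\<pi>) = (\<integral>x. g 0 x \<partial>\<pi>)"
      by (rule sym_measures_iterate[OF \<pi> _ g(1) i]) (simp_all add: g_def cyclic_shift_def)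
    also have "\<dots> = measure \<pi> ((\<lambda>x. x 0) -` K \<inter> space \<pi>)"
      using g(2)[of 0] N by (simp add: vimage_def Int_def conj_commute)
    also have "\<dots> = measure (distr \<pi> \<mu> (\<lambda>x. x 0)) K"
      using comp[of 0] N K by (subst measure_distr) auto
    also have "\<dots> = 0" using marginal K by simp
    finally have "measure \<pi> {x \<in> space \<pi>. x i \<in> K} = 0" using g(2)[OF i] by simp
    then have "{x \<in> space \<pi>. x i \<in> K} \<in> null_sets \<pi>"
      using KI[OF i] by (auto simp: null_sets_def \<pi>.emeasure_eq_measure)
    then show ?thesis by (rule AE_I') auto
  qed
  then have AE: "AE x in \<pi>. \<forall>i\<in>{..<N}. x i \<notin> K" by (intro AE_finite_allI) auto
  define g where "g = (\<lambda>i x. u (x i) \<bullet> (x i - x (Suc i mod N)))"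
  have g: "integrable \<pi> (g i)" if "i < N" for i
  proof (rule \<pi>.integrable_const_bound)
    have si: "Suc i mod N < N" using N by simp
    show "g i \<in> borel_measurable \<pi>"
      unfolding g_def meas by (rule cyclic_term_measurable[OF that si])
    show "AE x in \<pi>. norm (g i x) \<le> M * (2 * R)"
    proof (rule AE_I2)
      fix x assume "x \<in> space \<pi>"
      then have x: "x i \<in> \<Omega>" "x (Suc i mod N) \<in> \<Omega>" using that si unfolding space by (meson PiE_mem lessThan_iff)+
      have "\<bar>g i x\<bar> \<le> norm (u (x i)) * norm (x i - x (Suc i mod N))"
        unfolding g_def by (rule Cauchy_Schwarz_ineq2)
      also have "\<dots> \<le> M * (2 * R)"
        using norm_u[OF x(1)] norm_domain[OF x(1)] norm_domain[OF x(2)] M_nonneg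
          norm_triangle_ineq4[of "x i" "x (Suc i mod N)"] by (intro mult_mono) auto
      finally show "norm (g i x) \<le> M * (2 * R)" by simp
    qed
  qed
  have "0 \<le> (\<integral>x. (\<Sum>i<N. g i x) \<partial>\<pi>)"
  proof (rule integral_nonneg_AE, use AE AE_space in eventually_elim)
    fix x assume x: "\<forall>i\<in>{..<N}. x i \<notin> K" "x \<in> space \<pi>"
    then have "x i \<in> \<Omega> - \<Omega>\<^sub>0" if "i < N" for i using that by (auto simp: space K_def)
    from cyclically_monotone_onD[OF mono this] show "0 \<le> (\<Sum>i<N. g i x)" by (simp add: g_def)
  qed
  also have "\<dots> = (\<Sum>i<N. \<integral>x. g i x \<partial>\<pi>)" using g by (intro Bochner_Integration.integral_sum) auto
  also have "\<dots> = (\<Sum>i<N. \<integral>x. g 0 x \<partial>\<pi>)"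
  proof (rule sum.cong)
    fix i assume i: "i \<in> {..<N}"
    show "(\<integral>x. g i x \<partial>\<pi>) = (\<integral>x. g 0 x \<partial>\<pi>)"
      using i by (intro sym_measures_iterate[OF \<pi> _ g]) (simp_all add: g_def cyclic_shift_def)
  qed simp
  also have "\<dots> = N * transport_cost \<pi>" using N by (simp add: g_def transport_cost_def)
  finally show ?thesis using N by (simp add: zero_le_mult_iff)
qed

definition orbit_measure :: "('a \<Rightarrow> 'a) \<Rightarrow> (nat \<Rightarrow> 'a) measure" where
  "orbit_measure S = distr \<mu> product_space (\<lambda>x. \<lambda>i\<in>{..<N}. (S ^^ i) x)"

lemma orbit_measurable:
  assumes "S \<in> measurable \<mu> \<mu>"
  shows "(\<lambda>x. \<lambda>i\<in>{..<N}. (S ^^ i) x) \<in> measurable \<mu> product_space"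
proof (rule measurable_restrict)
  show "S ^^ i \<in> measurable \<mu> \<mu>" for i using assms by (rule measurable_compose_n)
qed

lemma cyclic_shift_measurable: "cyclic_shift N \<in> measurable product_space product_space"
proof -
  have "(\<lambda>x. x (Suc i mod N)) \<in> measurable product_space \<mu>" for i
    using N by (intro component_measurable) simp
  then have "(\<lambda>x. \<lambda>i\<in>{..<N}. x (Suc i mod N)) \<in> measurable product_space product_space"
    by (rule measurable_restrict)
  then show ?thesis unfolding cyclic_shift_def[abs_def] .
qed

text \<open>
  Since \<open>S\<close> returns to the identity after \<open>N\<close> steps, shifting the orbit of \<open>x\<close> cyclically gives the
  orbit of \<open>S x\<close>, and \<open>S\<close> preserves \<open>\<mu>\<close>.
\<close>

lemma orbit_measure_symmetric:
  assumes S: "S \<in> N_involutions N \<mu>"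
  shows "orbit_measure S \<in> sym_measures N \<mu>"
proof -
  note Sm = N_involutions_measurable[OF S]
  let ?G = "\<lambda>x. \<lambda>i\<in>{..<N}. (S ^^ i) x"
  note G = orbit_measurable[OF Sm]
  have "(\<integral>x. h x \<partial>orbit_measure S) = (\<integral>x. h (cyclic_shift N x) \<partial>orbit_measure S)"
    if "integrable (orbit_measure S) h" for h :: "_ \<Rightarrow> real"
  proof -
    have h: "h \<in> borel_measurable product_space"
      using borel_measurable_integrable[OF that] by (simp add: orbit_measure_def)
    have hG: "(\<lambda>x. h (?G x)) \<in> borel_measurable \<mu>" by (rule measurable_compose[OF G h])
    have hs: "(\<lambda>x. h (cyclic_shift N x)) \<in> borel_measurable product_space"
      by (rule measurable_compose[OF cyclic_shift_measurable h])
    have "(\<integral>x. h x \<partial>orbit_measure S) = (\<integral>x. h (?G x) \<partial>\<mu>)"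
      unfolding orbit_measure_def by (rule integral_distr[OF G h])
    also have "\<dots> = (\<integral>x. h (?G x) \<partial>distr \<mu> \<mu> S)"
      using S by (simp add: N_involutions_def measure_preserving_maps_def)
    also have "\<dots> = (\<integral>x. h (?G (S x)) \<partial>\<mu>)" by (rule integral_distr[OF Sm hG])
    also have "\<dots> = (\<integral>x. h (cyclic_shift N (?G x)) \<partial>\<mu>)"
    proof (rule integral_cong_AE)
      show "(\<lambda>x. h (?G (S x))) \<in> borel_measurable \<mu>" by (rule measurable_compose[OF Sm hG])
      show "(\<lambda>x. h (cyclic_shift N (?G x))) \<in> borel_measurable \<mu>" by (rule measurable_compose[OF G hs])
      have "AE x in \<mu>. (S ^^ N) x = x" using S by (simp add: N_involutions_def)
      then show "AE x in \<mu>. h (?G (S x)) = h (cyclic_shift N (?G x))"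
      proof eventually_elim
        fix x assume x: "(S ^^ N) x = x"
        \<comment> \<open>Only the last index wraps around, and there \<open>(S ^^ N) x = x\<close> is used.\<close>
        have "(S ^^ i) (S x) = (S ^^ (Suc i mod N)) x" if "i < N" for i
          using x that by (cases "Suc i = N") (auto simp: funpow_swap1)
        then have "?G (S x) = cyclic_shift N (?G x)" using N by (auto simp: cyclic_shift_def)
        then show "h (?G (S x)) = h (cyclic_shift N (?G x))" by simp
      qed
    qed
    also have "\<dots> = (\<integral>x. h (cyclic_shift N x) \<partial>orbit_measure S)"
      unfolding orbit_measure_def by (rule integral_distr[OF G hs, symmetric])
    finally show ?thesis .
  qed
  moreover have "distr (orbit_measure S) \<mu> (\<lambda>x. x 0) = \<mu>"
  proof -
    have "distr (orbit_measure S) \<mu> (\<lambda>x. x 0) = distr \<mu> \<mu> (\<lambda>x. ?G x 0)"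
      unfolding orbit_measure_def using component_measurable[of 0] N G
      by (subst distr_distr) (auto simp: comp_def)
    also have "\<dots> = \<mu>" using N by (simp add: distr_id)
    finally show ?thesis .
  qed
  moreover have "prob_space (orbit_measure S)"
    unfolding orbit_measure_def using G by (rule prob_space_distr)
  ultimately show ?thesis by (simp add: sym_measures_def orbit_measure_def)
qed

lemma orbit_measure_cost:
  assumes S: "S \<in> N_involutions N \<mu>"
  shows "transport_cost (orbit_measure S) = (\<integral>x. u x \<bullet> (x - S x) \<partial>\<mu>)"
proof -
  have "transport_cost (orbit_measure S) =
      (\<integral>x. u ((\<lambda>i\<in>{..<N}. (S ^^ i) x) 0) \<bullet> ((\<lambda>i\<in>{..<N}. (S ^^ i) x) 0 - (\<lambda>i\<in>{..<N}. (S ^^ i) x) 1) \<partial>\<mu>)"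
    unfolding orbit_measure_def transport_cost_def
    by (rule integral_distr[OF orbit_measurable[OF N_involutions_measurable[OF S]]])
      (rule cyclic_term_measurable; use N in simp)
  then show ?thesis using N by simp
qed

lemma diagonal_measure_eq: "diagonal_measure N \<mu> = orbit_measure id"
proof -
  have "(id ^^ i) x = x" for i and x :: 'a by (simp add: id_funpow)
  then show ?thesis unfolding diagonal_measure_def orbit_measure_def by simp
qed

definition in_polar :: bool where
  "in_polar \<longleftrightarrow> (\<forall>S\<in>N_involutions N \<mu>. 0 \<le> (\<integral>x. u x \<bullet> (x - S x) \<partial>\<mu>))"

lemma in_polar_iff_max:
  "in_polar \<longleftrightarrow> (\<forall>S\<in>N_involutions N \<mu>. (\<integral>x. u x \<bullet> S x \<partial>\<mu>) \<le> (\<integral>x. u x \<bullet> x \<partial>\<mu>))"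
proof -
  have "0 \<le> (\<integral>x. u x \<bullet> (x - S x) \<partial>\<mu>) \<longleftrightarrow> (\<integral>x. u x \<bullet> S x \<partial>\<mu>) \<le> (\<integral>x. u x \<bullet> x \<partial>\<mu>)"
    if "S \<in> N_involutions N \<mu>" for S
    unfolding integral_inner_diff[OF that] by linarith
  then show ?thesis unfolding in_polar_def by (rule ball_cong[OF refl])
qed

lemma cyclically_monotone_iff_in_polar:
  "(\<exists>\<Omega>\<^sub>0\<in>null_sets lebesgue. cyclically_monotone_on N (\<Omega> - \<Omega>\<^sub>0) u) \<longleftrightarrow> in_polar"
proof
  assume "\<exists>\<Omega>\<^sub>0\<in>null_sets lebesgue. cyclically_monotone_on N (\<Omega> - \<Omega>\<^sub>0) u"
  then show in_polar unfolding in_polar_def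
    using sym_measures_nonneg orbit_measure_symmetric orbit_measure_cost by metis
next
  assume in_polar
  then have "cyclically_monotone_on N essential_points u"
    by (intro polar_imp_cyclically_monotone) (auto simp: in_polar_def)
  moreover have "\<Omega> - (\<Omega> - essential_points) = essential_points" by (auto simp: essential_points_def)
  ultimately show "\<exists>\<Omega>\<^sub>0\<in>null_sets lebesgue. cyclically_monotone_on N (\<Omega> - \<Omega>\<^sub>0) u"
    using negligible_not_essential by (auto simp: negligible_iff_null_sets intro!: bexI[of _ "\<Omega> - essential_points"])
qed

lemma in_polarE:
  assumes in_polar
  obtains \<Omega>\<^sub>0 where "\<Omega>\<^sub>0 \<in> null_sets lebesgue" "cyclically_monotone_on N (\<Omega> - \<Omega>\<^sub>0) u"
proof -
  have "\<exists>\<Omega>\<^sub>0\<in>null_sets lebesgue. cyclically_monotone_on N (\<Omega> - \<Omega>\<^sub>0) u"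
    using assms by (rule cyclically_monotone_iff_in_polar[THEN iffD2])
  then obtain \<Omega>\<^sub>0 where "\<Omega>\<^sub>0 \<in> null_sets lebesgue" "cyclically_monotone_on N (\<Omega> - \<Omega>\<^sub>0) u" ..
  then show ?thesis by (rule that)
qed

lemma transport_problem_iff_in_polar:
  "((INF \<pi>\<in>sym_measures N \<mu>. transport_cost \<pi>) = 0 \<and>
    is_arg_min transport_cost (\<lambda>\<pi>. \<pi> \<in> sym_measures N \<mu>) (diagonal_measure N \<mu>)) \<longleftrightarrow> in_polar"
proof -
  have diag: "diagonal_measure N \<mu> \<in> sym_measures N \<mu>" "transport_cost (diagonal_measure N \<mu>) = 0"
    using orbit_measure_symmetric[OF id_involution] orbit_measure_cost[OF id_involution]
    by (simp_all add: diagonal_measure_eq)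
  show ?thesis
  proof
    assume in_polar
    then have nonneg: "0 \<le> transport_cost \<pi>" if "\<pi> \<in> sym_measures N \<mu>" for \<pi>
      using cyclically_monotone_iff_in_polar sym_measures_nonneg that by metis
    then have "bdd_below (transport_cost ` sym_measures N \<mu>)" by (rule bdd_belowI2)
    then have "(INF \<pi>\<in>sym_measures N \<mu>. transport_cost \<pi>) = transport_cost (diagonal_measure N \<mu>)"
      using INF_eq_value_iff[OF _ diag(1), of transport_cost] nonneg diag(2) by simp
    then show "(INF \<pi>\<in>sym_measures N \<mu>. transport_cost \<pi>) = 0 \<and>
        is_arg_min transport_cost (\<lambda>\<pi>. \<pi> \<in> sym_measures N \<mu>) (diagonal_measure N \<mu>)"
      using nonneg diag by (auto simp: is_arg_min_linorder)
  next
    assume "(INF \<pi>\<in>sym_measures N \<mu>. transport_cost \<pi>) = 0 \<and>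
      is_arg_min transport_cost (\<lambda>\<pi>. \<pi> \<in> sym_measures N \<mu>) (diagonal_measure N \<mu>)"
    then show in_polar unfolding in_polar_def
      using diag(2) orbit_measure_symmetric orbit_measure_cost is_arg_min_linorder by metis
  qed
qed

lemma polar_INF_iff: "(INF S\<in>N_involutions N \<mu>. \<integral>x. u x \<bullet> (x - S x) \<partial>\<mu>) = 0 \<longleftrightarrow> in_polar"
proof -
  have "(\<integral>x. u x \<bullet> x \<partial>\<mu>) - M * R \<le> (\<integral>x. u x \<bullet> (x - S x) \<partial>\<mu>)" if S: "S \<in> N_involutions N \<mu>" for S
  proof -
    have "(\<integral>x. u x \<bullet> S x \<partial>\<mu>) \<le> (\<integral>x. M * R \<partial>\<mu>)"
    proof (rule integral_mono[OF integrable_inner_involution[OF S]])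
      fix x assume "x \<in> space \<mu>"
      then have "norm (u x) * norm (S x) \<le> M * R"
        using norm_u norm_domain N_involutions_in_domain[OF S] M_nonneg by (intro mult_mono) (auto simp: space_mu)
      then show "u x \<bullet> S x \<le> M * R" using norm_cauchy_schwarz[of "u x" "S x"] by simp
    qed simp
    then show ?thesis by (simp add: integral_inner_diff[OF S] prob_space)
  qed
  then have "bdd_below ((\<lambda>S. \<integral>x. u x \<bullet> (x - S x) \<partial>\<mu>) ` N_involutions N \<mu>)" by (rule bdd_belowI2)
  from INF_eq_value_iff[OF this id_involution] show ?thesis by (simp add: in_polar_def)
qed

text \<open>
  Because \<open>S\<close> preserves \<open>\<mu>\<close>, the squared distance from \<open>u\<close> to \<open>S\<close> depends on \<open>S\<close> only through
  \<open>\<integral>\<langle>u(x), Sx\<rangle> d\<mu>\<close>.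
\<close>

lemma projection_iff_in_polar:
  "(INF S\<in>N_involutions N \<mu>. \<integral>x. (norm (u x - S x))\<^sup>2 \<partial>\<mu>) = (\<integral>x. (norm (u x - x))\<^sup>2 \<partial>\<mu>) \<longleftrightarrow> in_polar"
proof -
  have bounded_integrable: "integrable \<mu> (\<lambda>x. (norm (f x))\<^sup>2)"
    if f: "f \<in> borel_measurable \<mu>" "\<And>x. x \<in> \<Omega> \<Longrightarrow> norm (f x) \<le> b" for f :: "'a \<Rightarrow> 'a" and b
  proof (rule integrable_const_bound)
    show "AE x in \<mu>. norm ((norm (f x))\<^sup>2) \<le> b\<^sup>2"
      using f(2) by (intro AE_I2) (simp add: space_mu power_mono)
    show "(\<lambda>x. (norm (f x))\<^sup>2) \<in> borel_measurable \<mu>" using f(1) by measurable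
  qed
  have dist_eq: "(\<integral>x. (norm (u x - S x))\<^sup>2 \<partial>\<mu>)
      = (\<integral>x. (norm (u x))\<^sup>2 \<partial>\<mu>) + (\<integral>x. (norm x)\<^sup>2 \<partial>\<mu>) - 2 * (\<integral>x. u x \<bullet> S x \<partial>\<mu>)"
    if S: "S \<in> N_involutions N \<mu>" for S
  proof -
    have Sn: "integrable \<mu> (\<lambda>x. (norm (S x))\<^sup>2)"
      by (rule bounded_integrable[of _ R])
        (use N_involutions_borel[OF S] N_involutions_in_domain[OF S] norm_domain in auto)
    have un: "integrable \<mu> (\<lambda>x. (norm (u x))\<^sup>2)"
      by (rule bounded_integrable[of _ M]) (use norm_u in auto)
    have "(\<integral>x. (norm (u x - S x))\<^sup>2 \<partial>\<mu>)
        = (\<integral>x. (norm (u x))\<^sup>2 + (norm (S x))\<^sup>2 - 2 * (u x \<bullet> S x) \<partial>\<mu>)"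
      by (intro Bochner_Integration.integral_cong)
        (simp_all add: power2_norm_eq_inner inner_diff_left inner_diff_right inner_commute)
    also have "\<dots> = (\<integral>x. (norm (u x))\<^sup>2 \<partial>\<mu>) + (\<integral>x. (norm (S x))\<^sup>2 \<partial>\<mu>) - 2 * (\<integral>x. u x \<bullet> S x \<partial>\<mu>)"
      using Sn un integrable_inner_involution[OF S] by simp
    also have "(\<integral>x. (norm (S x))\<^sup>2 \<partial>\<mu>) = (\<integral>x. (norm x)\<^sup>2 \<partial>distr \<mu> \<mu> S)"
      using N_involutions_measurable[OF S] by (intro integral_distr[symmetric]) auto
    also have "distr \<mu> \<mu> S = \<mu>" using S by (simp add: N_involutions_def measure_preserving_maps_def)
    finally show ?thesis .
  qed
  have "bdd_below ((\<lambda>S. \<integral>x. (norm (u x - S x))\<^sup>2 \<partial>\<mu>) ` N_involutions N \<mu>)"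
    by (rule bdd_belowI2[where m = 0]) simp
  from INF_eq_value_iff[OF this id_involution] show ?thesis
    using dist_eq dist_eq[OF id_involution] by (simp add: in_polar_iff_max)
qed

text \<open>
  The complement of a null set is dense in an open set.
\<close>

lemma cyclically_monotone_field_off_null_set:
  assumes "\<Omega>\<^sub>0 \<in> null_sets lebesgue" "cyclically_monotone_on N (\<Omega> - \<Omega>\<^sub>0) u"
  shows "cyclically_monotone_field N \<Omega> (\<Omega> - \<Omega>\<^sub>0) u M"
proof
  show "\<Omega> \<subseteq> closure (\<Omega> - \<Omega>\<^sub>0)"
  proof
    fix x assume x: "x \<in> \<Omega>"
    show "x \<in> closure (\<Omega> - \<Omega>\<^sub>0)"
    proof (rule ccontr)
      assume not: "x \<notin> closure (\<Omega> - \<Omega>\<^sub>0)"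
      let ?V = "\<Omega> - closure (\<Omega> - \<Omega>\<^sub>0)"
      have "open ?V" "?V \<noteq> {}" using open_domain x not by auto
      then have "\<not> negligible ?V" by (rule open_not_negligible)
      moreover have "?V \<subseteq> \<Omega>\<^sub>0" using closure_subset[of "\<Omega> - \<Omega>\<^sub>0"] by auto
      ultimately show False
        using assms(1) negligible_subset[of \<Omega>\<^sub>0 ?V] by (simp add: negligible_iff_null_sets)
    qed
  qed
next
  show "\<Omega> - \<Omega>\<^sub>0 \<subseteq> \<Omega>" by blast
  show "norm (u x) \<le> M" if "x \<in> \<Omega> - \<Omega>\<^sub>0" for x using that norm_u by blast
qed (fact N open_domain convex_domain bounded_domain assms(2))+

lemma saddle_imp_cyclically_monotone:
  assumes H: "cyclically_sub_antisymmetric_on N \<Omega> H" "\<And>x. x \<in> \<Omega> \<Longrightarrow> convex_on \<Omega> (H x)"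
    and grad: "AE x in \<mu>. GDERIV (H x) x :> u x"
  shows "\<exists>\<Omega>\<^sub>0\<in>null_sets lebesgue. cyclically_monotone_on N (\<Omega> - \<Omega>\<^sub>0) u"
proof
  let ?K = "{x \<in> \<Omega>. \<not> GDERIV (H x) x :> u x}"
  show "?K \<in> null_sets lebesgue" using grad by (simp add: AE_mu_iff negligible_iff_null_sets)
  have tangent: "u x \<bullet> (y - x) \<le> H x y" if x: "x \<in> \<Omega> - ?K" and y: "y \<in> \<Omega>" for x y
  proof -
    have "u x \<bullet> (y - x) \<le> H x y - H x x"
      using x y by (intro convex_on_gderiv_tangent[OF H(2)]) auto
    moreover have "H x x = 0" using H(1) x by (auto simp: cyclically_sub_antisymmetric_on_def)
    ultimately show ?thesis by simp
  qed
  show "cyclically_monotone_on N (\<Omega> - ?K) u"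
    unfolding cyclically_monotone_on_def
  proof
    fix x assume x: "x \<in> {..<N} \<rightarrow>\<^sub>E \<Omega> - ?K"
    have "- (\<Sum>i<N. u (x i) \<bullet> (x i - x (Suc i mod N))) = (\<Sum>i<N. u (x i) \<bullet> (x (Suc i mod N) - x i))"
      unfolding sum_negf[symmetric] by (rule sum.cong) (simp_all add: inner_diff_right)
    also have "\<dots> \<le> (\<Sum>i<N. H (x i) (x (Suc i mod N)))"
    proof (rule sum_mono)
      fix i assume "i \<in> {..<N}"
      then have "x i \<in> \<Omega> - ?K" "x (Suc i mod N) \<in> \<Omega> - ?K" using x N by (auto simp: PiE_iff)
      then show "u (x i) \<bullet> (x (Suc i mod N) - x i) \<le> H (x i) (x (Suc i mod N))" by (intro tangent) auto
    qed
    also have "\<dots> \<le> 0"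
    proof -
      have "x \<in> {..<N} \<rightarrow>\<^sub>E \<Omega>" using x by (auto simp: PiE_iff)
      then show ?thesis using H(1) by (auto simp: cyclically_sub_antisymmetric_on_def)
    qed
    finally show "0 \<le> (\<Sum>i<N. u (x i) \<bullet> (x i - x (Suc i mod N)))" by simp
  qed
qed

lemma saddle_iff_in_polar:
  "(\<exists>H :: 'a \<Rightarrow> 'a \<Rightarrow> real.
       cyclically_sub_antisymmetric_on N \<Omega> H \<and>
       (\<forall>y\<in>\<Omega>. concave_on \<Omega> (\<lambda>x. H x y)) \<and>
       (\<forall>x\<in>\<Omega>. convex_on \<Omega> (\<lambda>y. H x y)) \<and>
       (\<forall>x\<in>\<Omega>. H x x = 0) \<and>
       (AE x in \<mu>. GDERIV (\<lambda>y. H x y) x :> u x)) \<longleftrightarrow> in_polar" (is "(\<exists>H. ?P H) \<longleftrightarrow> _")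
proof
  assume "\<exists>H. ?P H"
  then obtain H where "?P H" ..
  then show in_polar
    using saddle_imp_cyclically_monotone[of H] by (simp add: cyclically_monotone_iff_in_polar)
next
  assume in_polar
  then obtain \<Omega>\<^sub>0 where \<Omega>\<^sub>0: "\<Omega>\<^sub>0 \<in> null_sets lebesgue" "cyclically_monotone_on N (\<Omega> - \<Omega>\<^sub>0) u"
    by (rule in_polarE)
  interpret cyclically_monotone_field N \<Omega> "\<Omega> - \<Omega>\<^sub>0" u M
    by (rule cyclically_monotone_field_off_null_set[OF \<Omega>\<^sub>0])
  have "negligible (\<Omega>\<^sub>0 \<union> {x \<in> \<Omega> - \<Omega>\<^sub>0. \<not> GDERIV (saddle x) x :> u x})"
    using \<Omega>\<^sub>0(1) saddle_gderiv_ae by (intro negligible_Un) (auto simp: negligible_iff_null_sets)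
  then have "AE x in \<mu>. GDERIV (saddle x) x :> u x"
    unfolding AE_mu_iff by (rule negligible_subset) auto
  then show "\<exists>H. ?P H"
    using saddle_sub_antisymmetric saddle_concave saddle_convex saddle_diagonal
    by (intro exI[of _ saddle]) simp
qed

text \<open>
  Test the supremum with \<open>y\<^sub>i = x\<close>: on the constant tuple all shifts of \<open>H\<close> agree, so their vanishing
  sum forces \<open>H = 0\<close> there.
\<close>

lemma lagrangian_ge:
  assumes H: "H \<in> cyclically_antisymmetric_functions N \<Omega>" and x: "x \<in> \<Omega>"
  shows "ereal (p \<bullet> x) \<le> lagrangian N \<Omega> H x ((\<lambda>_. 0)(1 := p))"
proof -
  define c where "c = (\<lambda>i\<in>{..<N}. x)"
  have c: "c \<in> {..<N} \<rightarrow>\<^sub>E \<Omega>" using x by (auto simp: c_def)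
  have "cyclic_shift N c = c" using N by (simp add: c_def cyclic_shift_def restrict_def fun_eq_iff)
  then have "(cyclic_shift N ^^ i) c = c" for i by (induction i) auto
  then have "N * H c = 0" using H c by (auto simp: cyclically_antisymmetric_functions_def)
  then have Hc: "H c = 0" using N by simp
  define y where "y = (\<lambda>i\<in>{1..<N}. x)"
  have y: "y \<in> {1..<N} \<rightarrow>\<^sub>E \<Omega>" using x by (auto simp: y_def)
  have "y (0 := x) = c" using N by (auto simp: y_def c_def fun_eq_iff)
  moreover have "(\<Sum>i\<in>{1..<N}. ((\<lambda>_. 0)(1 := p)) i \<bullet> y i) = p \<bullet> x"
    unfolding sum_first_momentum[OF N] using N by (simp add: y_def)
  ultimately have "p \<bullet> x = (\<Sum>i\<in>{1..<N}. ((\<lambda>_. 0)(1 := p)) i \<bullet> y i) - H (y (0 := x))"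
    by (simp add: Hc)
  then show ?thesis unfolding lagrangian_def using y by (intro SUP_upper2[of y]) simp_all
qed

text \<open>
  The statement about the maximum is the polar condition itself. For the equality of the two extremal
  values, the infimum is attained at the antisymmetrized saddle function, where the Lagrangian equals
  \<open>\<langle>u(x), x\<rangle>\<close> off a null set.
\<close>

lemma duality_iff_in_polar:
  "((INF H \<in> cyclically_antisymmetric_functions N \<Omega>.
        ereal_integral \<mu> (\<lambda>x. lagrangian N \<Omega> H x ((\<lambda>_. 0)(1 := u x)))) =
     (SUP S \<in> N_involutions N \<mu>. ereal (\<integral>x. u x \<bullet> S x \<partial>\<mu>)) \<and>
     is_arg_max (\<lambda>S. \<integral>x. u x \<bullet> S x \<partial>\<mu>) (\<lambda>S. S \<in> N_involutions N \<mu>) id) \<longleftrightarrow> in_polar"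
  (is "?dual \<and> ?max \<longleftrightarrow> _")
proof -
  have max: "?max \<longleftrightarrow> in_polar"
    using id_involution by (auto simp: is_arg_max_linorder in_polar_iff_max)
  have ?dual if polar: in_polar
  proof -
    define I where "I = ereal (\<integral>x. u x \<bullet> x \<partial>\<mu>)"
    obtain \<Omega>\<^sub>0 where \<Omega>\<^sub>0: "\<Omega>\<^sub>0 \<in> null_sets lebesgue" "cyclically_monotone_on N (\<Omega> - \<Omega>\<^sub>0) u"
      using polar by (rule in_polarE)
    interpret cyclically_monotone_field N \<Omega> "\<Omega> - \<Omega>\<^sub>0" u M
      by (rule cyclically_monotone_field_off_null_set[OF \<Omega>\<^sub>0])
    define H where "H = antisymmetrization N saddle"
    have H: "H \<in> cyclically_antisymmetric_functions N \<Omega>"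
      unfolding H_def by (rule antisymmetrization_mem[OF N saddle_continuous])
    have le: "lagrangian N \<Omega> H x ((\<lambda>_. 0)(1 := u x)) \<le> ereal (u x \<bullet> x)" if x: "x \<in> \<Omega> - \<Omega>\<^sub>0" for x
      unfolding lagrangian_def
    proof (rule SUP_least)
      fix y assume y: "y \<in> {1..<N} \<rightarrow>\<^sub>E \<Omega>"
      have "y (0 := x) \<in> {..<N} \<rightarrow>\<^sub>E \<Omega>" using x y N by (auto simp: PiE_iff extensional_def)
      from antisymmetrization_ge[OF saddle_sub_antisymmetric this]
      have "saddle x (y 1) \<le> H (y (0 := x))" by (simp add: H_def)
      then show "ereal ((\<Sum>i\<in>{1..<N}. ((\<lambda>_. 0)(1 := u x)) i \<bullet> y i) - H (y (0 := x))) \<le> ereal (u x \<bullet> x)"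
        unfolding sum_first_momentum[OF N] using saddle_tangent[OF x, of "y 1"] by (simp add: inner_diff_right)
    qed
    have null: "AE x in \<mu>. x \<notin> \<Omega>\<^sub>0"
      unfolding AE_mu_iff using \<Omega>\<^sub>0(1) by (auto simp flip: negligible_iff_null_sets intro: negligible_subset)
    have "ereal_integral \<mu> (\<lambda>x. lagrangian N \<Omega> H x ((\<lambda>_. 0)(1 := u x))) = ereal_integral \<mu> (\<lambda>x. ereal (u x \<bullet> x))"
    proof (rule ereal_integral_cong_AE, use null AE_space in eventually_elim)
      fix x assume "x \<notin> \<Omega>\<^sub>0" "x \<in> space \<mu>"
      then show "lagrangian N \<Omega> H x ((\<lambda>_. 0)(1 := u x)) = ereal (u x \<bullet> x)"
        using le[of x] lagrangian_ge[OF H, of x "u x"] by (simp add: space_mu antisym)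
    qed
    then have HI: "ereal_integral \<mu> (\<lambda>x. lagrangian N \<Omega> H x ((\<lambda>_. 0)(1 := u x))) = I"
      by (simp add: ereal_integral_ereal[OF integrable_inner_self] I_def)
    have "(INF H \<in> cyclically_antisymmetric_functions N \<Omega>.
        ereal_integral \<mu> (\<lambda>x. lagrangian N \<Omega> H x ((\<lambda>_. 0)(1 := u x)))) = I"
    proof (rule antisym)
      show "(INF H \<in> cyclically_antisymmetric_functions N \<Omega>.
        ereal_integral \<mu> (\<lambda>x. lagrangian N \<Omega> H x ((\<lambda>_. 0)(1 := u x)))) \<le> I"
        by (rule INF_lower2[OF H]) (rule eq_refl[OF HI])
      show "I \<le> (INF H \<in> cyclically_antisymmetric_functions N \<Omega>.
        ereal_integral \<mu> (\<lambda>x. lagrangian N \<Omega> H x ((\<lambda>_. 0)(1 := u x))))"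
      proof (rule INF_greatest)
        fix H assume H: "H \<in> cyclically_antisymmetric_functions N \<Omega>"
        have "I = ereal_integral \<mu> (\<lambda>x. ereal (u x \<bullet> x))"
          by (simp add: ereal_integral_ereal[OF integrable_inner_self] I_def)
        also have "\<dots> \<le> ereal_integral \<mu> (\<lambda>x. lagrangian N \<Omega> H x ((\<lambda>_. 0)(1 := u x)))"
          by (intro ereal_integral_mono lagrangian_ge[OF H]) (simp add: space_mu)
        finally show "I \<le> ereal_integral \<mu> (\<lambda>x. lagrangian N \<Omega> H x ((\<lambda>_. 0)(1 := u x)))" .
      qed
    qed
    moreover have "(SUP S \<in> N_involutions N \<mu>. ereal (\<integral>x. u x \<bullet> S x \<partial>\<mu>)) = I"
    proof (rule antisym)
      show "(SUP S \<in> N_involutions N \<mu>. ereal (\<integral>x. u x \<bullet> S x \<partial>\<mu>)) \<le> I"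
        using polar unfolding I_def in_polar_iff_max by (intro SUP_least) simp
      show "I \<le> (SUP S \<in> N_involutions N \<mu>. ereal (\<integral>x. u x \<bullet> S x \<partial>\<mu>))"
        unfolding I_def by (rule SUP_upper2[OF id_involution]) simp
    qed
    ultimately show ?dual by simp
  qed
  then show ?thesis using max by blast
qed

end

theorem corollary9:
  fixes N :: nat and \<Omega> :: "'a::euclidean_space set" and u :: "'a \<Rightarrow> 'a" and \<mu> :: "'a measure"
  assumes "N \<ge> 2"
    and "\<Omega> \<noteq> {}" and "open \<Omega>" and "connected \<Omega>" and "bounded \<Omega>" and "convex \<Omega>"
    and "frontier \<Omega> \<in> null_sets lebesgue"
    and "\<mu> = normalized_lebesgue_on \<Omega>"
    and "u \<in> borel_measurable (lebesgue_on \<Omega>)" and "bounded (u ` \<Omega>)"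
  shows "all_equivalent
    [\<exists>\<Omega>\<^sub>0 \<in> null_sets lebesgue. cyclically_monotone_on N (\<Omega> - \<Omega>\<^sub>0) u,

     (INF \<pi> \<in> sym_measures N \<mu>. \<integral>x. u (x 0) \<bullet> (x 0 - x 1) \<partial>\<pi>) = 0 \<and>
     is_arg_min (\<lambda>\<pi>. \<integral>x. u (x 0) \<bullet> (x 0 - x 1) \<partial>\<pi>) (\<lambda>\<pi>. \<pi> \<in> sym_measures N \<mu>)
       (diagonal_measure N \<mu>),

     (INF S \<in> N_involutions N \<mu>. \<integral>x. u x \<bullet> (x - S x) \<partial>\<mu>) = 0,

     (INF S \<in> N_involutions N \<mu>. \<integral>x. (norm (u x - S x))\<^sup>2 \<partial>\<mu>) = (\<integral>x. (norm (u x - x))\<^sup>2 \<partial>\<mu>),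

     \<exists>H :: 'a \<Rightarrow> 'a \<Rightarrow> real.
       cyclically_sub_antisymmetric_on N \<Omega> H \<and>
       (\<forall>y\<in>\<Omega>. concave_on \<Omega> (\<lambda>x. H x y)) \<and>
       (\<forall>x\<in>\<Omega>. convex_on \<Omega> (\<lambda>y. H x y)) \<and>
       (\<forall>x\<in>\<Omega>. H x x = 0) \<and>
       (AE x in \<mu>. GDERIV (\<lambda>y. H x y) x :> u x),

     (INF H \<in> cyclically_antisymmetric_functions N \<Omega>.
        ereal_integral \<mu> (\<lambda>x. lagrangian N \<Omega> H x ((\<lambda>_. 0)(1 := u x)))) =
     (SUP S \<in> N_involutions N \<mu>. ereal (\<integral>x. u x \<bullet> S x \<partial>\<mu>)) \<and>
     is_arg_max (\<lambda>S. \<integral>x. u x \<bullet> S x \<partial>\<mu>) (\<lambda>S. S \<in> N_involutions N \<mu>) id]"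
proof -
  obtain R where R: "\<And>x. x \<in> \<Omega> \<Longrightarrow> norm x \<le> R"
    using \<open>bounded \<Omega>\<close> by (auto simp: bounded_iff)
  obtain M where M: "\<And>x. x \<in> \<Omega> \<Longrightarrow> norm (u x) \<le> M"
    using \<open>bounded (u ` \<Omega>)\<close> by (auto simp: bounded_iff)
  interpret vector_field_on_domain N \<Omega> u M R \<mu>
    by (unfold_locales; fact assms R M)
  show ?thesis
    unfolding all_equivalent_def transport_cost_def[abs_def, symmetric]
      cyclically_monotone_iff_in_polar transport_problem_iff_in_polar polar_INF_iff
      projection_iff_in_polar saddle_iff_in_polar duality_iff_in_polar
    by simp
qed

end
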